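(* Let $n>1$ and $m\ge1$ be integers, let $f,g_1,\dots,g_m\in\mathbb{R}[\bar z,z]$ be real-valued complex polynomials on $\mathbb{C}^n$ of respective degrees $k,k_1,\dots,k_m$, and let $K=\{z\in\mathbb{C}^n : g_i(z)\ge0,\ i=1,\dots,m\}$. Assume that one of the constraints defining $K$ is a sphere constraint $|z_1|^2+\dots+|z_n|^2=R^2$ for some $R>0$ (that is, both $R^2-\sum_j|z_j|^2$ and its opposite occur among $g_1,\dots,g_m$). Let $d\ge d^{\min}:=\max\{k,k_1,\dots,k_m\}$ and assume that $y\in\mathcal{H}_d$ is an optimal solution to the complex moment relaxation of order $d$, $$\rho_d:=\inf_{y\in\mathcal{H}_d}L_y(f)\ \text{ s.t. } y_{0,0}=1,\ M_{d-k_i}(g_iy)\succcurlyeq0,\ i=0,\dots,m\qquad(g_0:=1,\ k_0:=0).$$ Let $d_K:=\max_{1\le i\le m}k_i$ and let $t$ be an integer with $d^{\min}\le t\le d$. If 1. $\operatorname{rank}M_t(y)=\operatorname{rank}M_{t-d_K}(y)$ $(=:S)$, and 2. for all $1\le i<j\le n$, $$\begin{pmatrix} M_{t-d_K}(y) & M_{t-d_K}(\bar z_iy) & M_{t-d_K}(\bar z_jy) \\ M_{t-d_K}(z_iy) & M_{t-d_K}(|z_i|^2y) & M_{t-d_K}(\bar z_jz_iy) \\ M_{t-d_K}(z_jy) & M_{t-d_K}(\bar z_iz_jy) & M_{t-d_K}(|z_j|^2y) \end{pmatrix}\succcurlyeq0,$$ then $\rho_d=f^{\mathrm{opt}}:=\inf_{z\in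 K}f(z)$ and the problem of minimizing $f$ over $K$ has at least $S$ global solutions.
   Context: For $z\in\mathbb{C}^n$, $\alpha\in\mathbb{N}^n$: $z^\alpha=z_1^{\alpha_1}\cdots z_n^{\alpha_n}$, $|\alpha|=\alpha_1+\dots+\alpha_n$. $\mathbb{R}_l[\bar z,z]$ is the set of functions $\sum_{|\alpha|,|\beta|\le l}\varphi_{\alpha,\beta}\bar z^\alpha z^\beta$ ($\varphi_{\alpha,\beta}\in\mathbb{C}$) that are real-valued on $\mathbb{C}^n$; $\mathbb{R}[\bar z,z]=\bigcup_l\mathbb{R}_l[\bar z,z]$. The degree $k$ of $f$ means: $f\in\mathbb{R}_k[\bar z,z]$ and there exist $|\alpha|=k$, $|\beta|\le k$ with $f_{\alpha,\beta}\ne0$; similarly $k_i$ for $g_i$. $\mathcal{H}_d$ is the set of complex families $y=(y_{\alpha,\beta})_{|\alpha|,|\beta|\le d}$ (multi-indices in $\mathbb{N}^n$) with $\overline{y_{\alpha,\beta}}=y_{\beta,\alpha}$. $L_y$ is the linear functional with $L_y(\bar z^\alpha z^\beta)=y_{\alpha,\beta}$. For a polynomial $\varphi=\sum\varphi_{\gamma,\delta}\bar z^\gamma z^\delta$ with complex coefficients, $M_t(\varphi y)$ is the matrix indexed by $|\alpha|,|\beta|\le t$ with entries $M_t(\varphi y)(\alpha,\beta)=L_y(\varphi\,\bar z^\alpha z^\beta)=\sum_{\gamma,\delta}\varphi_{\gamma,\delta}\,y_{\alpha+\gamma,\beta+\delta}$, and $M_t(y)=(y_{\alpha,\beta})_{|\alpha|,|\beta|\le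 t}$. $\succcurlyeq0$ means Hermitian positive semidefinite. *)

theory Defs
  imports "HOL-Analysis.Analysis" "HOL-Library.Poly_Mapping" "HOL-Library.Function_Algebras"
begin

type_synonym 'n mindex = "'n \<Rightarrow>\<^sub>0 nat"

(* A polynomial in zbar, z is given by its coefficients: the key (\<alpha>, \<beta>) stands for
   the monomial zbar^\<alpha> z^\<beta>.  Distinct coefficient families define distinct functions
   on complex n-space, so this is the same as taking polynomial functions. *)
type_synonym 'n cpoly = "('n mindex \<times> 'n mindex) \<Rightarrow>\<^sub>0 complex"

definition mdeg :: "'n::finite mindex \<Rightarrow> nat" where
  "mdeg \<alpha> = (\<Sum>i\<in>UNIV. Poly_Mapping.lookup \<alpha> i)"

definition mindices :: "nat \<Rightarrow> 'n::finite mindex set" where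
  "mindices t = {\<alpha>. mdeg \<alpha> \<le> t}"

definition cmonom :: "'n mindex \<Rightarrow> 'n mindex \<Rightarrow> 'n cpoly" where
  "cmonom \<alpha> \<beta> = Poly_Mapping.single (\<alpha>, \<beta>) 1"

definition zvar :: "'n \<Rightarrow> 'n cpoly" where
  "zvar i = cmonom 0 (Poly_Mapping.single i 1)"

definition zbar :: "'n \<Rightarrow> 'n cpoly" where
  "zbar i = cmonom (Poly_Mapping.single i 1) 0"

definition mpow :: "complex ^ 'n \<Rightarrow> 'n::finite mindex \<Rightarrow> complex" where
  "mpow z \<alpha> = (\<Prod>i\<in>UNIV. (z $ i) ^ Poly_Mapping.lookup \<alpha> i)"

definition ceval :: "'n::finite cpoly \<Rightarrow> complex ^ 'n \<Rightarrow> complex" where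
  "ceval \<phi> z = (\<Sum>(\<alpha>, \<beta>)\<in>Poly_Mapping.keys \<phi>. Poly_Mapping.lookup \<phi> (\<alpha>, \<beta>) * cnj (mpow z \<alpha>) * mpow z \<beta>)"

definition real_cpolys :: "nat \<Rightarrow> 'n::finite cpoly set" where
  "real_cpolys l = {\<phi>. (\<forall>(\<alpha>, \<beta>)\<in>Poly_Mapping.keys \<phi>. mdeg \<alpha> \<le> l \<and> mdeg \<beta> \<le> l) \<and> (\<forall>z. ceval \<phi> z \<in> \<real>)}"

(* The zero polynomial has no degree. *)
definition has_cdegree :: "'n::finite cpoly \<Rightarrow> nat \<Rightarrow> bool" where
  "has_cdegree \<phi> k \<longleftrightarrow> \<phi> \<in> real_cpolys k \<and>
     (\<exists>\<alpha> \<beta>. mdeg \<alpha> = k \<and> mdeg \<beta> \<le> k \<and> Poly_Mapping.lookup \<phi> (\<alpha>, \<beta>) \<noteq> 0)"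

definition sphere_poly :: "real \<Rightarrow> 'n::finite cpoly" where
  "sphere_poly R = Poly_Mapping.single 0 (complex_of_real (R\<^sup>2)) - (\<Sum>j\<in>UNIV. zbar j * zvar j)"

definition semialg_set :: "nat \<Rightarrow> (nat \<Rightarrow> 'n::finite cpoly) \<Rightarrow> (complex ^ 'n) set" where
  "semialg_set m g = {z. \<forall>i\<in>{1..m}. Re (ceval (g i) z) \<ge> 0}"

(* Families indexed by multi-indices of degree at most d, encoded as total functions that
   vanish outside this range. *)
definition herm_seqs :: "nat \<Rightarrow> ('n::finite mindex \<Rightarrow> 'n mindex \<Rightarrow> complex) set" where
  "herm_seqs d = {y. (\<forall>\<alpha> \<beta>. \<alpha> \<notin> mindices d \<or> \<beta> \<notin> mindices d \<longrightarrow> y \<alpha> \<beta> = 0) \<and>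
     (\<forall>\<alpha>\<in>mindices d. \<forall>\<beta>\<in>mindices d. cnj (y \<alpha> \<beta>) = y \<beta> \<alpha>)}"

definition riesz :: "('n mindex \<Rightarrow> 'n mindex \<Rightarrow> complex) \<Rightarrow> 'n cpoly \<Rightarrow> complex" where
  "riesz y \<phi> = (\<Sum>(\<gamma>, \<delta>)\<in>Poly_Mapping.keys \<phi>. Poly_Mapping.lookup \<phi> (\<gamma>, \<delta>) * y \<gamma> \<delta>)"

(* Matrices are functions of row and column index; M_t(\<phi> y) is moment_mat \<phi> y on the
   index set mindices t, and M_t(y) is the case \<phi> = 1. *)
definition moment_mat ::
    "'n cpoly \<Rightarrow> ('n mindex \<Rightarrow> 'n mindex \<Rightarrow> complex) \<Rightarrow> 'n mindex \<Rightarrow> 'n mindex \<Rightarrow> complex" where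
  "moment_mat \<phi> y \<alpha> \<beta> = riesz y (\<phi> * cmonom \<alpha> \<beta>)"

lemma moment_mat_1: "moment_mat 1 y \<alpha> \<beta> = y \<alpha> \<beta>"
  by (simp add: moment_mat_def riesz_def cmonom_def)

lemma moment_mat_eq_sum:
  "moment_mat \<phi> y \<alpha> \<beta> = (\<Sum>(\<gamma>, \<delta>)\<in>Poly_Mapping.keys \<phi>. Poly_Mapping.lookup \<phi> (\<gamma>, \<delta>) * y (\<alpha> + \<gamma>) (\<beta> + \<delta>))"
proof -
  define s where "s p = p + (\<alpha>, \<beta>)" for p :: "'a mindex \<times> 'a mindex"
  have inj: "inj s"
    by (auto simp: s_def inj_def)
  have \<phi>: "\<phi> = (\<Sum>p\<in>Poly_Mapping.keys \<phi>. Poly_Mapping.single p (Poly_Mapping.lookup \<phi> p))"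
    by (rule poly_mapping_eqI) (simp add: lookup_sum lookup_single when_def in_keys_iff)
  have prod: "\<phi> * cmonom \<alpha> \<beta> = (\<Sum>p\<in>Poly_Mapping.keys \<phi>. Poly_Mapping.single (s p) (Poly_Mapping.lookup \<phi> p))"
    by (subst \<phi>) (simp add: sum_distrib_right cmonom_def mult_single s_def)
  have look: "Poly_Mapping.lookup (\<phi> * cmonom \<alpha> \<beta>) (s p) = Poly_Mapping.lookup \<phi> p" for p
  proof -
    have "Poly_Mapping.lookup (\<phi> * cmonom \<alpha> \<beta>) (s p) = (\<Sum>q\<in>Poly_Mapping.keys \<phi>. if q = p then Poly_Mapping.lookup \<phi> q else 0)"
      unfolding prod lookup_sum lookup_single when_def
      by (intro sum.cong) (auto dest: injD[OF inj])
    also have "\<dots> = Poly_Mapping.lookup \<phi> p"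
      by (simp add: in_keys_iff)
    finally show ?thesis .
  qed
  have sub: "Poly_Mapping.keys (\<phi> * cmonom \<alpha> \<beta>) \<subseteq> s ` Poly_Mapping.keys \<phi>"
    unfolding prod by (rule order.trans[OF keys_sum]) auto
  have keys: "Poly_Mapping.keys (\<phi> * cmonom \<alpha> \<beta>) = s ` Poly_Mapping.keys \<phi>"
    using sub look by (auto simp: in_keys_iff)
  show ?thesis
    unfolding moment_mat_def riesz_def keys
    by (subst sum.reindex[OF inj_on_subset[OF inj]])
       (auto simp: case_prod_unfold look intro!: sum.cong, simp add: s_def add.commute)
qed

definition hermitian_psd :: "'a set \<Rightarrow> ('a \<Rightarrow> 'a \<Rightarrow> complex) \<Rightarrow> bool" where
  "hermitian_psd I M \<longleftrightarrow> (\<forall>a\<in>I. \<forall>b\<in>I. cnj (M a b) = M b a) \<and>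
     (\<forall>v. Re (\<Sum>a\<in>I. \<Sum>b\<in>I. cnj (v a) * M a b * v b) \<ge> 0)"

lemma vector_space_cfun: "vector_space (\<lambda>(c::complex) (f::'a \<Rightarrow> complex) x. c * f x)"
  by unfold_locales (auto simp: algebra_simps fun_eq_iff)

(* Complex dimension of the column space; columns are extended by zero outside I. *)
definition mat_rank :: "'a set \<Rightarrow> ('a \<Rightarrow> 'a \<Rightarrow> complex) \<Rightarrow> nat" where
  "mat_rank I M = vector_space.dim (\<lambda>(c::complex) (f::'a \<Rightarrow> complex) x. c * f x)
     ((\<lambda>b a. if a \<in> I then M a b else 0) ` I)"

definition moment_feasible ::
    "nat \<Rightarrow> nat \<Rightarrow> (nat \<Rightarrow> 'n::finite cpoly) \<Rightarrow> (nat \<Rightarrow> nat) \<Rightarrow> ('n mindex \<Rightarrow> 'n mindex \<Rightarrow> complex) set"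
  where
  "moment_feasible d m g kg = {y \<in> herm_seqs d. y 0 0 = 1 \<and>
     hermitian_psd (mindices d) (moment_mat 1 y) \<and>
     (\<forall>i\<in>{1..m}. hermitian_psd (mindices (d - kg i)) (moment_mat (g i) y))}"

(* The infima are taken in the extended reals; riesz y f and ceval f z are real for
   real-valued f. *)
definition moment_value ::
    "nat \<Rightarrow> 'n::finite cpoly \<Rightarrow> nat \<Rightarrow> (nat \<Rightarrow> 'n cpoly) \<Rightarrow> (nat \<Rightarrow> nat) \<Rightarrow> ereal" where
  "moment_value d f m g kg = (INF y\<in>moment_feasible d m g kg. ereal (Re (riesz y f)))"

definition moment_optimal ::
    "nat \<Rightarrow> 'n::finite cpoly \<Rightarrow> nat \<Rightarrow> (nat \<Rightarrow> 'n cpoly) \<Rightarrow> (nat \<Rightarrow> nat)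
      \<Rightarrow> ('n mindex \<Rightarrow> 'n mindex \<Rightarrow> complex) \<Rightarrow> bool" where
  "moment_optimal d f m g kg y \<longleftrightarrow> y \<in> moment_feasible d m g kg \<and>
     (\<forall>y'\<in>moment_feasible d m g kg. Re (riesz y f) \<le> Re (riesz y' f))"

definition opt_value :: "'n::finite cpoly \<Rightarrow> (complex ^ 'n) set \<Rightarrow> ereal" where
  "opt_value f K = (INF z\<in>K. ereal (Re (ceval f z)))"

definition global_solutions :: "'n::finite cpoly \<Rightarrow> (complex ^ 'n) set \<Rightarrow> (complex ^ 'n) set" where
  "global_solutions f K = {z \<in> K. \<forall>w\<in>K. Re (ceval f z) \<le> Re (ceval f w)}"

(* Blocks of the 3 x 3 block matrix are addressed by p, q < 3, its rows and columns by
   pairs of a block number and a multi-index. *)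
definition shift_block_mat ::
    "'n \<Rightarrow> 'n \<Rightarrow> ('n mindex \<Rightarrow> 'n mindex \<Rightarrow> complex) \<Rightarrow> nat \<times> 'n mindex \<Rightarrow> nat \<times> 'n mindex \<Rightarrow> complex"
  where
  "shift_block_mat i j y = (\<lambda>(p, \<alpha>) (q, \<beta>). moment_mat
     ([[1,      zbar i,          zbar j],
       [zvar i, zvar i * zbar i, zbar j * zvar i],
       [zvar j, zbar i * zvar j, zvar j * zbar j]] ! p ! q) y \<alpha> \<beta>)"

end

theory Submission
  imports Defs "HOL-Computational_Algebra.Fundamental_Theorem_Algebra"
begin

text \<open>The truncated moment matrix of order $t$ is a Gram matrix $y_{\alpha\beta} = \langle x_\alpha, x_\beta\rangle$ of vectors in
  complex $S$-space, and by the rank condition the $x_\alpha$ with $|\alpha| \le t - d_K$ already span. The sphere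
  constraint gives $\sum_j \|\sum_\alpha c_\alpha x_{\alpha+e_j}\|^2 = R^2 \|\sum_\alpha c_\alpha x_\alpha\|^2$, so the shifts
  $x_\alpha \mapsto x_{\alpha+e_i}$ are well-defined operators $T_i$. Positivity of the block matrices, after a Schur
  complement whose trace vanishes, yields $T_j^* T_i = T_i T_j^*$ for all $i, j$. Hence the $T_i$ have a joint
  orthonormal eigenbasis; the joint eigenvalues are the atoms of a measure representing $y$ up to order $t$.
  Polynomials of degree at most $t - d_K$ interpolate on the atoms, so the localizing matrices force
  the atoms into $K$, and the relaxation value, being both a lower bound for $f$ on $K$ and the average of
  $f$ over the atoms, is attained at every atom.\<close>

section \<open>Gram vectors and rank\<close>

text \<open>In the real moment problem, Hankel structure lets a variable move from the row index to
  the column index, so multiplication preserves null vectors of the moment matrix. Here zbar and z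
  are distinguished and no such move exists. The norm identity from the sphere takes its place: the
  squared norms of all shifts of a null combination sum to zero, so each shift vanishes. Degrees
  count zbar and z separately, so the sphere polynomial has degree 1; hence d_K is at least 1, and
  shifting an index of degree at most t - d_K stays within order t. With T_0 the identity, block (p,
  q) of the block matrix represents T_q^* T_p, and the Schur complement of the identity block has
  blocks T_q^* T_p - T_p T_q^*. Positivity is thus joint hyponormality of the shifts. It becomes an
  equality because the trace of a commutator vanishes in finite dimension. The case i = j, normality
  of T_i, is read off from a pair containing i, and such a pair exists because n > 1.\<close>

definition scale_fun :: "complex \<Rightarrow> ('a \<Rightarrow> complex) \<Rightarrow> 'a \<Rightarrow> complex" where
  "scale_fun c f = (\<lambda>x. c * f x)"

lemma scale_fun_apply [simp]: "scale_fun c f x = c * f x"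
  by (simp add: scale_fun_def)

interpretation cfun: vector_space scale_fun
  by unfold_locales (auto simp: algebra_simps fun_eq_iff)

lemma sum_fun_apply: "(\<Sum>i\<in>A. f i) x = (\<Sum>i\<in>A. f i x)"
  for f :: "'i \<Rightarrow> 'a \<Rightarrow> 'b::comm_monoid_add"
  by (induction A rule: infinite_finite_induct) auto

lemma sum_scale_fun_apply [simp]:
  "(\<Sum>i\<in>A. scale_fun (c i) (f i)) x = (\<Sum>i\<in>A. c i * f i x)"
  by (simp add: sum_fun_apply)

lemma mat_rank_alt: "mat_rank I M = cfun.dim ((\<lambda>b a. if a \<in> I then M a b else 0) ` I)"
proof -
  have "scale_fun = (\<lambda>c (f::'a \<Rightarrow> complex) x. c * f x)"
    by (simp add: fun_eq_iff)
  then show ?thesis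
    by (simp add: mat_rank_def)
qed

text \<open>Pairing a vanishing combination of the \<open>u s\<close> with \<open>\<phi> q\<close>
  isolates its \<open>q\<close>-th coefficient, so the \<open>u s\<close> are independent; the
  exchange bound against a basis of \<open>V\<close> then applies.\<close>

lemma card_le_dim_dual_family:
  fixes u \<phi> :: "nat \<Rightarrow> 'a \<Rightarrow> complex"
  assumes fin: "finite V" and sp: "\<And>s. s < r \<Longrightarrow> u s \<in> cfun.span V"
    and dual: "\<And>s q. s < r \<Longrightarrow> q < r \<Longrightarrow> (\<Sum>a\<in>I. \<phi> q a * u s a) = (if s = q then 1 else 0)"
  shows "r \<le> cfun.dim V"
proof -
  have inj: "inj_on u {..<r}"
  proof (rule inj_onI)
    fix s q assume sq: "s \<in> {..<r}" "q \<in> {..<r}" "u s = u q"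
    with dual[of s q] dual[of q q] show "s = q"
      by (auto split: if_splits)
  qed
  have "cfun.independent (u ` {..<r})"
  proof (rule cfun.independent_if_scalars_zero)
    fix c x assume 0: "(\<Sum>x\<in>u ` {..<r}. scale_fun (c x) x) = 0" and "x \<in> u ` {..<r}"
    then obtain q where q: "q < r" "x = u q" by auto
    have "(\<Sum>s<r. scale_fun (c (u s)) (u s)) = 0"
      using 0 by (simp add: sum.reindex[OF inj])
    then have *: "(\<Sum>s<r. c (u s) * u s a) = 0" for a
      by (metis sum_scale_fun_apply zero_fun_apply)
    have "0 = (\<Sum>a\<in>I. \<phi> q a * (\<Sum>s<r. c (u s) * u s a))"
      by (simp add: *)
    also have "\<dots> = (\<Sum>s<r. c (u s) * (\<Sum>a\<in>I. \<phi> q a * u s a))"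
      unfolding sum_distrib_left by (subst sum.swap) (simp add: mult_ac)
    also have "\<dots> = (\<Sum>s<r. if s = q then c (u s) else 0)"
      using dual q by (intro sum.cong) auto
    also have "\<dots> = c x"
      using q by simp
    finally show "c x = 0" by simp
  qed simp
  moreover obtain B where B: "B \<subseteq> V" "cfun.independent B" "V \<subseteq> cfun.span B" "card B = cfun.dim V"
    by (rule cfun.basis_exists)
  have "u ` {..<r} \<subseteq> cfun.span B"
    using sp cfun.span_mono[OF B(3)] by (auto simp: cfun.span_span)
  moreover have "finite B"
    using B fin finite_subset by blast
  ultimately have "card (u ` {..<r}) \<le> card B"
    using cfun.independent_span_bound by blast
  then show ?thesis
    by (simp add: card_image[OF inj] B)
qed

text \<open>Dependence in \<open>cfun\<close> is a property of sets, so a family with a repeated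
  member is treated apart, with coefficients 1 and -1. The result supplies an annihilating
  polynomial for the iterates of a matrix.\<close>

lemma finite_support_dependent:
  fixes f :: "nat \<Rightarrow> nat \<Rightarrow> complex"
  assumes supp: "\<And>i s. i \<le> S \<Longrightarrow> s \<ge> S \<Longrightarrow> f i s = 0"
  obtains c where "\<exists>i\<le>S. c i \<noteq> 0" "\<And>s. (\<Sum>i\<le>S. c i * f i s) = 0"
proof (cases "inj_on f {..S}")
  case True
  define \<delta> where "\<delta> q = (\<lambda>s::nat. if s = q then 1 else (0::complex))" for q
  have "f i \<in> cfun.span (\<delta> ` {..<S})" if "i \<le> S" for i
  proof -
    have "f i = (\<Sum>q<S. scale_fun (f i q) (\<delta> q))"
    proof
      fix s
      have "(\<Sum>q<S. f i q * \<delta> q s) = (\<Sum>q<S. if q = s then f i q else 0)"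
        by (intro sum.cong) (auto simp: \<delta>_def)
      then show "f i s = (\<Sum>q<S. scale_fun (f i q) (\<delta> q)) s"
        using supp[OF that, of s] by auto
    qed
    also have "\<dots> \<in> cfun.span (\<delta> ` {..<S})"
      by (intro cfun.span_sum cfun.span_scale cfun.span_base) auto
    finally show ?thesis .
  qed
  then have sp: "f ` {..S} \<subseteq> cfun.span (\<delta> ` {..<S})" by auto
  have "\<not> cfun.independent (f ` {..S})"
  proof
    assume "cfun.independent (f ` {..S})"
    then have "card (f ` {..S}) \<le> card (\<delta> ` {..<S})"
      using cfun.independent_span_bound[OF _ _ sp] by simp
    moreover have "card (\<delta> ` {..<S}) \<le> S"
      using card_image_le[of "{..<S}" \<delta>] by simp
    ultimately show False
      by (simp add: card_image[OF True])
  qed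
  then obtain d where d: "\<exists>x\<in>f ` {..S}. d x \<noteq> 0" "(\<Sum>x\<in>f ` {..S}. scale_fun (d x) x) = 0"
    by (auto simp: cfun.dependent_finite)
  show ?thesis
  proof
    show "\<exists>i\<le>S. (d \<circ> f) i \<noteq> 0" using d(1) by auto
    show "(\<Sum>i\<le>S. (d \<circ> f) i * f i s) = 0" for s
      using fun_cong[OF d(2), of s] by (simp add: sum.reindex[OF True])
  qed
next
  case False
  then obtain i j where ij: "i \<le> S" "j \<le> S" "i \<noteq> j" "f i = f j"
    by (auto simp: inj_on_def)
  define c where "c l = (if l = i then 1 else if l = j then -1 else (0::complex))" for l
  show ?thesis
  proof
    show "\<exists>l\<le>S. c l \<noteq> 0" using ij by (auto simp: c_def)
    fix s
    have "(\<Sum>l\<le>S. c l * f l s) = (\<Sum>l\<in>{i,j}. c l * f l s)"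
      using ij by (intro sum.mono_neutral_right) (auto simp: c_def)
    then show "(\<Sum>l\<le>S. c l * f l s) = 0"
      using ij by (simp add: c_def)
  qed
qed

section \<open>Sesquilinear forms of positive semidefinite matrices\<close>

definition sesq :: "'a set \<Rightarrow> ('a \<Rightarrow> 'a \<Rightarrow> complex) \<Rightarrow> ('a \<Rightarrow> complex) \<Rightarrow> ('a \<Rightarrow> complex) \<Rightarrow> complex" where
  "sesq I M u v = (\<Sum>a\<in>I. \<Sum>b\<in>I. cnj (u a) * M a b * v b)"

lemma sesq_sum_right: "sesq I M u (\<lambda>b. \<Sum>s\<in>A. c s * v s b) = (\<Sum>s\<in>A. c s * sesq I M u (v s))"
proof -
  have "sesq I M u (\<lambda>b. \<Sum>s\<in>A. c s * v s b)
      = (\<Sum>a\<in>I. \<Sum>b\<in>I. \<Sum>s\<in>A. c s * (cnj (u a) * M a b * v s b))"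
    by (simp add: sesq_def sum_distrib_left mult_ac)
  also have "\<dots> = (\<Sum>s\<in>A. \<Sum>a\<in>I. \<Sum>b\<in>I. c s * (cnj (u a) * M a b * v s b))"
    by (subst sum.swap[where A = I and B = A], subst sum.swap[where A = I and B = A]) (rule refl)
  finally show ?thesis
    by (simp add: sesq_def sum_distrib_left)
qed

lemma sesq_diff_right: "sesq I M u (\<lambda>b. v b - w b) = sesq I M u v - sesq I M u w"
  by (simp add: sesq_def algebra_simps sum_subtractf)

lemma sesq_scale_right: "sesq I M u (\<lambda>b. c * v b) = c * sesq I M u v"
  by (simp add: sesq_def sum_distrib_left mult_ac)

lemma cnj_sesq:
  assumes "hermitian_psd I M"
  shows "cnj (sesq I M u v) = sesq I M v u"
proof -
  have "cnj (sesq I M u v) = (\<Sum>a\<in>I. \<Sum>b\<in>I. u a * cnj (M a b) * cnj (v b))"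
    by (simp add: sesq_def cnj_sum)
  also have "\<dots> = (\<Sum>b\<in>I. \<Sum>a\<in>I. cnj (v b) * M b a * u a)"
    using assms by (subst sum.swap) (auto simp: hermitian_psd_def mult_ac intro!: sum.cong)
  finally show ?thesis by (simp add: sesq_def)
qed

lemma sesq_diff_left: "sesq I M (\<lambda>b. v b - w b) u = sesq I M v u - sesq I M w u"
  by (simp add: sesq_def algebra_simps sum_subtractf)

lemma sesq_sum_left:
  assumes "hermitian_psd I M"
  shows "sesq I M (\<lambda>b. \<Sum>s\<in>A. c s * v s b) u = (\<Sum>s\<in>A. cnj (c s) * sesq I M (v s) u)"
proof -
  have "sesq I M (\<lambda>b. \<Sum>s\<in>A. c s * v s b) u = cnj (\<Sum>s\<in>A. c s * sesq I M u (v s))"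
    by (simp only: sesq_sum_right[symmetric] cnj_sesq[OF assms])
  then show ?thesis
    by (simp add: cnj_sum cnj_sesq[OF assms])
qed

lemma sesq_scale_left: "sesq I M (\<lambda>b. c * v b) u = cnj c * sesq I M v u"
  by (simp add: sesq_def sum_distrib_left mult_ac)

lemma sesq_self_nonneg:
  assumes "hermitian_psd I M"
  shows "sesq I M v v = complex_of_real (Re (sesq I M v v))" "Re (sesq I M v v) \<ge> 0"
proof -
  show "sesq I M v v = complex_of_real (Re (sesq I M v v))"
    using cnj_sesq[OF assms, of v v] by (simp add: complex_eq_iff)
  show "Re (sesq I M v v) \<ge> 0"
    using assms by (simp add: hermitian_psd_def sesq_def)
qed

lemma sesq_unit_vectors:
  assumes "finite I" "a \<in> I" "b \<in> I"
  shows "sesq I M (\<lambda>x. if x = a then 1 else 0) (\<lambda>x. if x = b then 1 else 0) = M a b"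
  using assms unfolding sesq_def
  by (simp add: if_distrib[of cnj] if_distrib[of "\<lambda>x. x * _"] if_distrib[of "\<lambda>x. _ * x"] cong: if_cong)

lemma hermitian_psd_diag_nonneg:
  assumes "finite I" "hermitian_psd I M" "a \<in> I"
  shows "0 \<le> Re (M a a)"
  using sesq_self_nonneg(2)[OF assms(2), of "\<lambda>x. if x = a then 1 else 0"]
  by (simp only: sesq_unit_vectors[OF assms(1,3,3)])

lemma sesq_restrict:
  assumes "finite I" "J \<subseteq> I"
  shows "sesq J M u w = sesq I M (\<lambda>a. if a \<in> J then u a else 0) (\<lambda>a. if a \<in> J then w a else 0)"
proof -
  have "sesq J M u w = (\<Sum>a\<in>J. \<Sum>b\<in>I. cnj (u a) * M a b * (if b \<in> J then w b else 0))"
    unfolding sesq_def using assms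
    by (intro sum.cong sum.mono_neutral_cong_left) auto
  also have "\<dots> = sesq I M (\<lambda>a. if a \<in> J then u a else 0) (\<lambda>a. if a \<in> J then w a else 0)"
    unfolding sesq_def using assms
    by (intro sum.mono_neutral_cong_left) auto
  finally show ?thesis .
qed

lemma hermitian_psd_subset:
  assumes "hermitian_psd I M" "finite I" "J \<subseteq> I"
  shows "hermitian_psd J M"
  unfolding hermitian_psd_def
proof (intro conjI ballI allI)
  show "cnj (M a b) = M b a" if "a \<in> J" "b \<in> J" for a b
    using assms that by (auto simp: hermitian_psd_def)
  show "0 \<le> Re (\<Sum>a\<in>J. \<Sum>b\<in>J. cnj (u a) * M a b * u b)" for u
    using sesq_self_nonneg(2)[OF assms(1)] sesq_restrict[OF assms(2,3), of M u u]
    by (simp add: sesq_def)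
qed

text \<open>A nonnegative diagonal with zero sum is zero. The form at
  \<open>e_a - cnj (M a b) e_b\<close> then equals -2 |M a b|^2, and it must be nonnegative.\<close>

lemma hermitian_psd_zero_trace:
  assumes fin: "finite I" and psd: "hermitian_psd I M" and tr: "(\<Sum>a\<in>I. M a a) = 0"
    and ab: "a \<in> I" "b \<in> I"
  shows "M a b = 0"
proof -
  have herm: "cnj (M a b) = M b a" if "a \<in> I" "b \<in> I" for a b
    using psd that by (simp add: hermitian_psd_def)
  note diag = sesq_unit_vectors[OF fin]
  have nonneg: "Re (M a a) \<ge> 0" if "a \<in> I" for a
    by (rule hermitian_psd_diag_nonneg[OF fin psd that])
  have "(\<Sum>a\<in>I. Re (M a a)) = 0"
    using arg_cong[OF tr, of Re] by simp
  then have "Re (M a a) = 0" if "a \<in> I" for a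
    using nonneg that fin by (simp add: sum_nonneg_eq_0_iff)
  then have zero: "M a a = 0" if "a \<in> I" for a
    using herm[OF that that] that by (auto simp: complex_eq_iff)
  define c where "c = cnj (M a b)"
  define u where "u = (\<lambda>x. if x = a then 1 else (0::complex))"
  define w where "w = (\<lambda>x. - c * (if x = b then 1 else (0::complex)))"
  \<comment> \<open>The vector \<open>u + w\<close> is written as a difference so that
    \<open>sesq_diff_left\<close> and \<open>sesq_diff_right\<close> expand the form.\<close>
  have "sesq I M (\<lambda>x. u x - - w x) (\<lambda>x. u x - - w x)
      = sesq I M u u + sesq I M u w + sesq I M w u + sesq I M w w"
    by (simp only: sesq_diff_right sesq_diff_left)
       (simp add: sesq_def sum_negf)
  also have "sesq I M u u = 0"
    unfolding u_def diag[OF ab(1) ab(1)] by (rule zero[OF ab(1)])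
  also have "sesq I M u w = - c * M a b"
    unfolding w_def sesq_scale_right by (simp add: u_def diag ab)
  also have "sesq I M w u = - cnj c * M b a"
    unfolding w_def sesq_scale_left by (simp add: u_def diag ab)
  also have "sesq I M w w = 0"
    unfolding w_def sesq_scale_left sesq_scale_right by (simp add: diag ab zero)
  finally have "Re (- c * M a b - cnj c * M b a) \<ge> 0"
    using sesq_self_nonneg(2)[OF psd, of "\<lambda>x. u x - - w x"] by simp
  then have "- 2 * ((Re (M a b))\<^sup>2 + (Im (M a b))\<^sup>2) \<ge> 0"
    by (simp add: c_def herm[OF ab, symmetric] power2_eq_square)
  then have "(Re (M a b))\<^sup>2 + (Im (M a b))\<^sup>2 \<le> 0" by simp
  then show ?thesis
    by (simp add: complex_eq_iff sum_power2_le_zero_iff)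
qed

text \<open>Serves to turn the two opposite sphere inequalities into linear equations between
  moments: both signs of the diagonal are nonnegative, so the trace is zero.\<close>

lemma hermitian_psd_minus_zero:
  assumes "finite I" "hermitian_psd I M" "hermitian_psd I (\<lambda>a b. - M a b)" "a \<in> I" "b \<in> I"
  shows "M a b = 0"
proof -
  have "M c c = 0" if "c \<in> I" for c
  proof -
    have "Re (M c c) = 0"
      using hermitian_psd_diag_nonneg[OF assms(1,2) that] hermitian_psd_diag_nonneg[OF assms(1,3) that]
      by simp
    moreover have "cnj (M c c) = M c c"
      using assms(2) that by (simp add: hermitian_psd_def)
    ultimately show ?thesis by (simp add: complex_eq_iff)
  qed
  then show ?thesis
    using assms by (intro hermitian_psd_zero_trace[of I M]) auto
qed

section \<open>Maximal orthonormal families and Gram factorization\<close>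

text \<open>The form of \<open>M\<close> may be degenerate. For positive semidefinite
  \<open>M\<close> the greatest length of such a family is the rank, which is how rank hypotheses
  become coordinates.\<close>

definition orthonormal_family ::
    "'a set \<Rightarrow> ('a \<Rightarrow> 'a \<Rightarrow> complex) \<Rightarrow> nat \<Rightarrow> (nat \<Rightarrow> 'a \<Rightarrow> complex) \<Rightarrow> bool" where
  "orthonormal_family I M r v \<longleftrightarrow> (\<forall>s<r. \<forall>q<r. sesq I M (v s) (v q) = (if s = q then 1 else 0))"

text \<open>The vectors \<open>M v_s\<close> lie in the column space, and pairing them with the
  conjugates of the \<open>v_q\<close> exhibits a dual family.\<close>

lemma orthonormal_le_mat_rank:
  fixes r :: nat
  assumes fin: "finite I" and on: "orthonormal_family I M r v"
  shows "r \<le> mat_rank I M"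
  unfolding mat_rank_alt
proof (rule card_le_dim_dual_family)
  define col where "col b = (\<lambda>a. if a \<in> I then M a b else 0)" for b
  define u where "u s = (\<Sum>b\<in>I. scale_fun (v s b) (col b))" for s
  show "finite ((\<lambda>b a. if a \<in> I then M a b else 0) ` I)" using fin by simp
  show "u s \<in> cfun.span ((\<lambda>b a. if a \<in> I then M a b else 0) ` I)" if "s < r" for s
    unfolding u_def by (intro cfun.span_sum cfun.span_scale cfun.span_base) (auto simp: col_def)
  show "(\<Sum>a\<in>I. cnj (v q a) * u s a) = (if s = q then 1 else 0)" if "s < r" "q < r" for s q
  proof -
    have "(\<Sum>a\<in>I. cnj (v q a) * u s a) = sesq I M (v q) (v s)"
      by (simp add: u_def col_def sesq_def sum_distrib_left mult_ac)
    also have "\<dots> = (if s = q then 1 else 0)"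
      using on that by (auto simp: orthonormal_family_def)
    finally show ?thesis .
  qed
qed

lemma mat_rank_le_gram:
  assumes "\<And>a b. a \<in> I \<Longrightarrow> b \<in> I \<Longrightarrow> M a b = (\<Sum>s<r. x a s * z b s)"
  shows "mat_rank I M \<le> r"
proof -
  define w where "w s = (\<lambda>a. if a \<in> I then x a s else 0)" for s :: nat
  have "(\<lambda>b a. if a \<in> I then M a b else 0) ` I \<subseteq> cfun.span (w ` {..<r})"
  proof (rule image_subsetI)
    fix b assume "b \<in> I"
    then have "(\<lambda>a. if a \<in> I then M a b else 0) = (\<Sum>s<r. scale_fun (z b s) (w s))"
      using assms by (auto simp: fun_eq_iff w_def mult.commute)
    also have "\<dots> \<in> cfun.span (w ` {..<r})"
      by (intro cfun.span_sum cfun.span_scale cfun.span_base) auto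
    finally show "(\<lambda>a. if a \<in> I then M a b else 0) \<in> cfun.span (w ` {..<r})" .
  qed
  then have "mat_rank I M \<le> card (w ` {..<r})"
    unfolding mat_rank_alt by (intro cfun.dim_le_card) auto
  also have "\<dots> \<le> r"
    using card_image_le[of "{..<r}" w] by simp
  finally show ?thesis .
qed

text \<open>\<open>x b s\<close> is the coordinate of the unit vector at \<open>b\<close> along
  \<open>v s\<close>. If the residual \<open>proj u\<close> had positive norm, normalizing it would
  extend the family; so the form vanishes on residuals. Therefore \<open>M\<close> minus the Gram
  matrix has zero quadratic form, and a positive semidefinite matrix with zero diagonal is
  zero.\<close>

lemma maximal_orthonormal_imp_gram:
  assumes fin: "finite I" and psd: "hermitian_psd I M" and on: "orthonormal_family I M r v"
    and max: "\<nexists>v'. orthonormal_family I M (Suc r) v'"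
    and ab: "a \<in> I" "b \<in> I"
  defines "x \<equiv> \<lambda>b s. \<Sum>a\<in>I. cnj (v s a) * M a b"
  shows "M a b = (\<Sum>s<r. cnj (x a s) * x b s)"
proof -
  define proj where "proj u = (\<lambda>b. u b - (\<Sum>s<r. sesq I M (v s) u * v s b))" for u
  have orth: "sesq I M (v q) (proj u) = 0" if "q < r" for q u
  proof -
    have "(\<Sum>s<r. sesq I M (v s) u * sesq I M (v q) (v s)) = (\<Sum>s<r. if s = q then sesq I M (v s) u else 0)"
      using on that by (intro sum.cong) (auto simp: orthonormal_family_def)
    then show ?thesis
      using that by (simp add: proj_def sesq_diff_right sesq_sum_right)
  qed
  have orth': "sesq I M (proj u) (v q) = 0" if "q < r" for q u
    using orth[OF that, of u] cnj_sesq[OF psd, of "v q" "proj u"] by simp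
  have null: "sesq I M (proj u) (proj u) = 0" for u
  proof (rule ccontr)
    assume nz: "sesq I M (proj u) (proj u) \<noteq> 0"
    define h where "h = sqrt (Re (sesq I M (proj u) (proj u)))"
    have h: "h > 0" "complex_of_real (h\<^sup>2) = sesq I M (proj u) (proj u)"
      using nz sesq_self_nonneg[OF psd, of "proj u"] by (auto simp: h_def)
        (metis less_eq_real_def of_real_0)
    define v' where "v' s = (if s = r then (\<lambda>b. complex_of_real (1 / h) * proj u b) else v s)" for s
    have "orthonormal_family I M (Suc r) v'"
      unfolding orthonormal_family_def
    proof (intro allI impI)
      fix s q assume "s < Suc r" "q < Suc r"
      then consider "s = r" "q = r" | "s = r" "q < r" | "s < r" "q = r" | "s < r" "q < r"
        by linarith
      then show "sesq I M (v' s) (v' q) = (if s = q then 1 else 0)"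
      proof cases
        case 1
        have "complex_of_real (1 / h) * (complex_of_real (1 / h) * complex_of_real (h\<^sup>2)) = 1"
          unfolding of_real_mult[symmetric] using h(1) by (simp add: power2_eq_square)
        then show ?thesis
          using 1 by (simp add: v'_def sesq_scale_left sesq_scale_right h(2)[symmetric]
              del: of_real_divide of_real_power)
      next
        case 2 then show ?thesis
          by (simp add: v'_def sesq_scale_left orth' del: of_real_divide)
      next
        case 3 then show ?thesis
          by (simp add: v'_def sesq_scale_right orth del: of_real_divide)
      next
        case 4 then show ?thesis
          using on by (simp add: v'_def orthonormal_family_def)
      qed
    qed
    with max show False by blast
  qed
  define N where "N a b = M a b - (\<Sum>s<r. cnj (x a s) * x b s)" for a b
  have vx: "sesq I M (v s) u = (\<Sum>b\<in>I. x b s * u b)" for s u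
    unfolding sesq_def x_def by (subst sum.swap) (simp add: sum_distrib_right)
  have sesqN: "sesq I N u u = sesq I M (proj u) (proj u)" for u
  proof -
    have "sesq I N u u = sesq I M u u - (\<Sum>a\<in>I. \<Sum>b\<in>I. \<Sum>s<r. (cnj (x a s) * cnj (u a)) * (x b s * u b))"
      by (simp add: sesq_def N_def algebra_simps sum_subtractf sum_distrib_left)
    also have "(\<Sum>a\<in>I. \<Sum>b\<in>I. \<Sum>s<r. (cnj (x a s) * cnj (u a)) * (x b s * u b))
        = (\<Sum>s<r. \<Sum>a\<in>I. \<Sum>b\<in>I. (cnj (x a s) * cnj (u a)) * (x b s * u b))"
      by (subst (2) sum.swap, subst sum.swap) simp
    also have "\<dots> = (\<Sum>s<r. cnj (sesq I M (v s) u) * sesq I M (v s) u)"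
      by (simp add: vx cnj_sum sum_product)
    also have "\<dots> = (\<Sum>s<r. sesq I M (v s) u * sesq I M u (v s))"
      by (simp add: cnj_sesq[OF psd] mult.commute)
    also have "sesq I M u u - \<dots> = sesq I M u (proj u)"
      by (simp add: proj_def sesq_diff_right sesq_sum_right)
    also have "\<dots> = sesq I M (proj u) (proj u)"
      by (subst (2) proj_def)
         (simp add: sesq_diff_left sesq_sum_left[OF psd] orth)
    finally show ?thesis .
  qed
  have psdN: "hermitian_psd I N"
    unfolding hermitian_psd_def
  proof (intro conjI ballI allI)
    show "cnj (N a b) = N b a" if "a \<in> I" "b \<in> I" for a b
      using psd that by (simp add: N_def hermitian_psd_def cnj_sum mult.commute)
    show "0 \<le> Re (\<Sum>a\<in>I. \<Sum>b\<in>I. cnj (u a) * N a b * u b)" for u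
      using sesqN[of u] null[of u] by (simp add: sesq_def)
  qed
  have "N a a = 0" if "a \<in> I" for a
    using sesqN[of "\<lambda>x. if x = a then 1 else 0"] by (simp add: null sesq_unit_vectors[OF fin that that])
  then have "N a b = 0"
    by (intro hermitian_psd_zero_trace[OF fin psdN _ ab]) simp
  then show ?thesis by (simp add: N_def)
qed

text \<open>The orthonormal family is chosen maximal on the smaller set \<open>J\<close>, where
  maximality forces its length to be the rank \<open>S\<close>. Extended by zero it is still maximal
  on \<open>I\<close>, since a longer family would exceed the rank there. Coordinates on all of
  \<open>I\<close> are thus taken against vectors supported on \<open>J\<close>, and this yields the
  dual family \<open>v\<close> over \<open>J\<close> alone.\<close>

lemma gram_factorization_rank:
  fixes I J :: "'a set"
  assumes fin: "finite I" and J: "J \<subseteq> I" and psd: "hermitian_psd I M"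
    and rI: "mat_rank I M = S" and rJ: "mat_rank J M = S"
  obtains x :: "'a \<Rightarrow> nat \<Rightarrow> complex" and v :: "nat \<Rightarrow> 'a \<Rightarrow> complex" where
    "\<And>a b. a \<in> I \<Longrightarrow> b \<in> I \<Longrightarrow> M a b = (\<Sum>s<S. cnj (x a s) * x b s)"
    "\<And>s q. s < S \<Longrightarrow> q < S \<Longrightarrow> (\<Sum>b\<in>J. v s b * x b q) = (if s = q then 1 else 0)"
proof -
  have finJ: "finite J" using fin J finite_subset by blast
  note ext = sesq_restrict[OF fin J]
  have psdJ: "hermitian_psd J M"
    by (rule hermitian_psd_subset[OF psd fin J])
  define P where "P r \<longleftrightarrow> (\<exists>v. orthonormal_family J M r v)" for r :: nat
  have P0: "P 0" by (simp add: P_def orthonormal_family_def)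
  have bd: "\<forall>r. P r \<longrightarrow> r \<le> S"
    using orthonormal_le_mat_rank[OF finJ] rJ by (auto simp: P_def)
  define r where "r = (GREATEST r. P r)"
  have "P r" unfolding r_def using GreatestI_nat[of P 0 S] P0 bd by blast
  then obtain v where v: "orthonormal_family J M r v" by (auto simp: P_def)
  have "\<not> P (Suc r)"
    using Greatest_le_nat[of P "Suc r" S] bd unfolding r_def by auto
  then have max: "\<nexists>v'. orthonormal_family J M (Suc r) v'" by (simp add: P_def)
  have "S \<le> r"
    unfolding rJ[symmetric]
    by (rule mat_rank_le_gram) (rule maximal_orthonormal_imp_gram[OF finJ psdJ v max])
  with bd \<open>P r\<close> have r: "r = S" by (simp add: le_antisym)
  define v' where "v' s = (\<lambda>a. if a \<in> J then v s a else 0)" for s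
  have v': "orthonormal_family I M S v'"
    using v by (simp add: orthonormal_family_def ext v'_def r)
  have max': "\<nexists>v'. orthonormal_family I M (Suc S) v'"
    using orthonormal_le_mat_rank[OF fin] rI by (metis not_less_eq_eq order_refl)
  show ?thesis
  proof
    show "M a b = (\<Sum>s<S. cnj (\<Sum>c\<in>I. cnj (v' s c) * M c a) * (\<Sum>c\<in>I. cnj (v' s c) * M c b))"
      if "a \<in> I" "b \<in> I" for a b
      by (rule maximal_orthonormal_imp_gram[OF fin psd v' max' that])
    show "(\<Sum>b\<in>J. v s b * (\<Sum>c\<in>I. cnj (v' q c) * M c b)) = (if s = q then 1 else 0)"
      if "s < S" "q < S" for s q
    proof -
      have "(\<Sum>b\<in>J. v s b * (\<Sum>c\<in>I. cnj (v' q c) * M c b))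
          = (\<Sum>b\<in>I. v' s b * (\<Sum>c\<in>I. cnj (v' q c) * M c b))"
        using fin J by (intro sum.mono_neutral_cong_left) (auto simp: v'_def)
      also have "\<dots> = sesq I M (v' q) (v' s)"
        unfolding sesq_def sum_distrib_left
        by (subst sum.swap) (simp add: mult_ac)
      also have "\<dots> = (if s = q then 1 else 0)"
        using v' that by (auto simp: orthonormal_family_def)
      finally show ?thesis .
    qed
  qed
qed

lemmas fun_apply = plus_fun_apply zero_fun_apply minus_apply uminus_apply scale_fun_apply sum_scale_fun_apply

text \<open>As simp rules these would unfold vectors pointwise inside operator equations.\<close>
declare fun_apply [simp del]

section \<open>Commuting normal matrices\<close>

definition ip :: "nat \<Rightarrow> (nat \<Rightarrow> complex) \<Rightarrow> (nat \<Rightarrow> complex) \<Rightarrow> complex" where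
  "ip S u v = (\<Sum>s<S. cnj (u s) * v s)"

definition mv :: "nat \<Rightarrow> (nat \<Rightarrow> nat \<Rightarrow> complex) \<Rightarrow> (nat \<Rightarrow> complex) \<Rightarrow> nat \<Rightarrow> complex" where
  "mv S A u = (\<lambda>s. if s < S then \<Sum>q<S. A s q * u q else 0)"

definition adj :: "(nat \<Rightarrow> nat \<Rightarrow> complex) \<Rightarrow> nat \<Rightarrow> nat \<Rightarrow> complex" where
  "adj A = (\<lambda>s q. cnj (A q s))"

text \<open>Complex \<open>S\<close>-space, encoded as sequences that vanish from \<open>S\<close>
  on. \<open>ip\<close> sees only the first \<open>S\<close> entries, so definiteness holds just on
  this set.\<close>

definition vecs :: "nat \<Rightarrow> (nat \<Rightarrow> complex) set" where
  "vecs S = {u. \<forall>s\<ge>S. u s = 0}"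

lemma adj_adj [simp]: "adj (adj A) = A"
  by (simp add: adj_def)

lemma cnj_ip: "cnj (ip S u v) = ip S v u"
  by (simp add: ip_def cnj_sum mult.commute)

lemma ip_add_left: "ip S (u + v) w = ip S u w + ip S v w"
  and ip_add_right: "ip S w (u + v) = ip S w u + ip S w v"
  and ip_diff_left: "ip S (u - v) w = ip S u w - ip S v w"
  and ip_diff_right: "ip S w (u - v) = ip S w u - ip S w v"
  and ip_minus_left: "ip S (- u) w = - ip S u w"
  and ip_minus_right: "ip S w (- u) = - ip S w u"
  and ip_scale_left: "ip S (scale_fun c u) w = cnj c * ip S u w"
  and ip_scale_right: "ip S w (scale_fun c u) = c * ip S w u"
  by (simp_all add: fun_apply ip_def algebra_simps sum.distrib sum_subtractf sum_distrib_left sum_negf)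

lemmas ip_simps = ip_add_left ip_add_right ip_diff_left ip_diff_right ip_minus_left
  ip_minus_right ip_scale_left ip_scale_right

lemma ip_zero [simp]: "ip S 0 u = 0" "ip S u 0 = 0"
  by (simp_all add: ip_def fun_apply)

lemma ip_sum_right: "ip S w (\<Sum>i\<in>A. u i) = (\<Sum>i\<in>A. ip S w (u i))"
  for u :: "'i \<Rightarrow> nat \<Rightarrow> complex"
  by (induction A rule: infinite_finite_induct) (simp_all add: ip_add_right)

lemma ip_sum_left: "ip S (\<Sum>i\<in>A. u i) w = (\<Sum>i\<in>A. ip S (u i) w)"
  for u :: "'i \<Rightarrow> nat \<Rightarrow> complex"
  by (induction A rule: infinite_finite_induct) (simp_all add: ip_add_left)

lemma ip_self: "ip S u u = complex_of_real (\<Sum>s<S. (cmod (u s))\<^sup>2)"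
  unfolding ip_def of_real_sum by (simp add: complex_norm_square[symmetric] mult.commute)

lemma ip_self_eq_0:
  assumes "u \<in> vecs S" "ip S u u = 0"
  shows "u = 0"
proof
  fix s
  have "(\<Sum>s<S. (cmod (u s))\<^sup>2) = 0"
    using assms(2) unfolding ip_self by (simp only: of_real_eq_0_iff)
  then have "\<forall>s<S. u s = 0"
    by (auto simp: sum_nonneg_eq_0_iff)
  then show "u s = 0 s"
    using assms(1) by (cases "s < S") (auto simp: vecs_def fun_apply)
qed

lemma mv_vecs [simp]: "mv S A u \<in> vecs S"
  by (simp add: mv_def vecs_def)

lemma mv_add: "mv S A (u + v) = mv S A u + mv S A v"
  and mv_minus: "mv S A (- u) = - mv S A u"
  and mv_scale: "mv S A (scale_fun c u) = scale_fun c (mv S A u)"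
  and mv_0 [simp]: "mv S A 0 = 0"
  by (simp_all add: fun_apply mv_def fun_eq_iff algebra_simps sum.distrib sum_subtractf sum_distrib_left sum_negf)

lemma mv_sum: "mv S A (\<Sum>i\<in>X. u i) = (\<Sum>i\<in>X. mv S A (u i))"
  for u :: "'i \<Rightarrow> nat \<Rightarrow> complex"
  by (induction X rule: infinite_finite_induct) (simp_all add: mv_add)

lemma ip_mv_left: "ip S (mv S A u) v = ip S u (mv S (adj A) v)"
proof -
  have "ip S (mv S A u) v = (\<Sum>s<S. \<Sum>q<S. cnj (A s q) * cnj (u q) * v s)"
    by (simp add: ip_def mv_def cnj_sum sum_distrib_right)
  also have "\<dots> = (\<Sum>q<S. \<Sum>s<S. cnj (A s q) * cnj (u q) * v s)"
    by (rule sum.swap)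
  finally show ?thesis
    by (simp add: ip_def mv_def adj_def sum_distrib_left mult_ac)
qed

lemma ip_mv_right: "ip S u (mv S A v) = ip S (mv S (adj A) u) v"
  by (simp add: ip_mv_left)

lemma mv_commute:
  assumes "\<And>s q. s < S \<Longrightarrow> q < S \<Longrightarrow> (\<Sum>r<S. A s r * B r q) = (\<Sum>r<S. B s r * A r q)"
  shows "mv S A (mv S B u) = mv S B (mv S A u)"
proof
  fix s
  have *: "mv S A (mv S B u) s = (if s < S then \<Sum>q<S. (\<Sum>r<S. A s r * B r q) * u q else 0)" for A B
  proof -
    have "(\<Sum>r<S. \<Sum>q<S. A s r * (B r q * u q)) = (\<Sum>q<S. \<Sum>r<S. A s r * (B r q * u q))"
      by (rule sum.swap)
    then show ?thesis
      by (simp add: mv_def sum_distrib_left sum_distrib_right mult.assoc)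
  qed
  show "mv S A (mv S B u) s = mv S B (mv S A u) s"
    unfolding * using assms by simp
qed

text \<open>For normal \<open>A\<close> the norms of \<open>A u\<close> and of its adjoint image
  agree, so the squared norm of \<open>adj A u - cnj c u\<close> expands to that of
  \<open>A u - c u\<close>, which is zero.\<close>

lemma normal_eigenvector_adj:
  fixes u :: "nat \<Rightarrow> complex"
  assumes normal: "\<And>u. mv S (adj A) (mv S A u) = mv S A (mv S (adj A) u)"
    and u: "u \<in> vecs S" "mv S A u = scale_fun c u"
  shows "mv S (adj A) u = scale_fun (cnj c) u"
proof -
  define w where "w = mv S (adj A) u - scale_fun (cnj c) u"
  have eq: "ip S (mv S (adj A) u) (mv S (adj A) u) = ip S (mv S A u) (mv S A u)"
    by (simp add: ip_mv_left normal)
  have "ip S w w = ip S (mv S A u) (mv S A u) - cnj c * ip S (mv S (adj A) u) u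
      - c * ip S u (mv S (adj A) u) + c * cnj c * ip S u u"
    by (simp add: w_def ip_simps eq algebra_simps)
  also have "ip S (mv S (adj A) u) u = ip S u (mv S A u)"
    by (simp add: ip_mv_left)
  also have "ip S u (mv S (adj A) u) = ip S (mv S A u) u"
    by (simp add: ip_mv_left)
  finally have "ip S w w = 0"
    by (simp add: u(2) ip_simps algebra_simps)
  moreover have "w \<in> vecs S"
    using u(1) mv_vecs[of S "adj A" u] by (simp add: w_def vecs_def fun_apply)
  ultimately have "w = 0" by (intro ip_self_eq_0)
  then show ?thesis by (simp add: w_def)
qed

section \<open>Eigenvectors and joint diagonalization\<close>

text \<open>The polynomial \<open>p\<close> evaluated at the operator \<open>A\<close> and applied
  to \<open>u\<close>.\<close>

definition pmv :: "nat \<Rightarrow> (nat \<Rightarrow> nat \<Rightarrow> complex) \<Rightarrow> complex poly \<Rightarrow> (nat \<Rightarrow> complex) \<Rightarrow> nat \<Rightarrow> complex" where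
  "pmv S A p u = (\<Sum>i\<le>degree p. scale_fun (coeff p i) ((mv S A ^^ i) u))"

lemma pmv_eq:
  assumes "degree p \<le> n"
  shows "pmv S A p u = (\<Sum>i\<le>n. scale_fun (coeff p i) ((mv S A ^^ i) u))"
  unfolding pmv_def using assms
  by (intro sum.mono_neutral_left) (auto simp: coeff_eq_0)

lemma pmv_linear_factor:
  "pmv S A ([:- c, 1:] * q) u = mv S A (pmv S A q u) - scale_fun c (pmv S A q u)"
proof -
  have 1: "pmv S A (pCons 0 q) u = mv S A (pmv S A q u)"
  proof -
    have "pmv S A (pCons 0 q) u = (\<Sum>i\<le>Suc (degree q). scale_fun (coeff (pCons 0 q) i) ((mv S A ^^ i) u))"
      by (rule pmv_eq) (simp add: degree_pCons_le)
    also have "\<dots> = (\<Sum>i\<le>degree q. scale_fun (coeff q i) ((mv S A ^^ Suc i) u))"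
      by (subst sum.atMost_Suc_shift) simp
    finally show ?thesis
      by (simp add: pmv_def mv_sum mv_scale)
  qed
  have "pmv S A ([:- c, 1:] * q) u = (\<Sum>i\<le>Suc (degree q).
      scale_fun (coeff (pCons 0 q) i) ((mv S A ^^ i) u) - scale_fun c (scale_fun (coeff q i) ((mv S A ^^ i) u)))"
  proof (subst pmv_eq)
    show "degree ([:- c, 1:] * q) \<le> Suc (degree q)"
      using degree_mult_le[of "[:- c, 1:]" q] by simp
    show "(\<Sum>i\<le>Suc (degree q). scale_fun (coeff ([:- c, 1:] * q) i) ((mv S A ^^ i) u)) =
        (\<Sum>i\<le>Suc (degree q). scale_fun (coeff (pCons 0 q) i) ((mv S A ^^ i) u) -
          scale_fun c (scale_fun (coeff q i) ((mv S A ^^ i) u)))"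
      by (intro sum.cong refl) (simp add: fun_eq_iff fun_apply algebra_simps)
  qed
  also have "\<dots> = pmv S A (pCons 0 q) u - scale_fun c (pmv S A q u)"
    unfolding sum_subtractf cfun.scale_sum_right[symmetric]
    by (subst (1 2) pmv_eq[where n = "Suc (degree q)"]) (simp_all add: degree_pCons_le)
  finally show ?thesis by (simp add: 1)
qed

text \<open>The iterates of \<open>w\<close> up to exponent \<open>S\<close> are dependent, so a
  nonzero polynomial annihilates \<open>w\<close>. Take the least degree over all pairs of a nonzero
  polynomial and a nonzero vector of \<open>W\<close> that it annihilates. A constant would kill the
  vector, so there is a root \<open>z\<close>; splitting off its linear factor leaves
  \<open>q\<close>, and the image of \<open>u\<close> under \<open>q\<close> is nonzero by
  minimality and is an eigenvector for \<open>z\<close>.\<close>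

lemma ex_eigenvector:
  fixes W :: "(nat \<Rightarrow> complex) set"
  assumes sub: "cfun.subspace W" and W: "W \<subseteq> vecs S" and inv: "\<And>u. u \<in> W \<Longrightarrow> mv S A u \<in> W"
    and w: "w \<in> W" "w \<noteq> 0"
  obtains u c where "u \<in> W" "u \<noteq> 0" "mv S A u = scale_fun c u"
proof -
  have pow: "(mv S A ^^ i) u \<in> W" if "u \<in> W" for i u
    using that by (induction i) (auto intro: inv)
  have pmvW: "pmv S A p u \<in> W" if "u \<in> W" for p u
    unfolding pmv_def using that
    by (intro cfun.subspace_sum[OF sub] cfun.subspace_scale[OF sub] pow)
  define P where "P n \<longleftrightarrow> (\<exists>p u. p \<noteq> 0 \<and> degree p = n \<and> u \<in> W \<and> u \<noteq> 0 \<and> pmv S A p u = 0)" for n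
  obtain c where c: "\<exists>i\<le>S. c i \<noteq> 0" "\<And>s. (\<Sum>i\<le>S. c i * (mv S A ^^ i) w s) = 0"
    using finite_support_dependent[of S "\<lambda>i. (mv S A ^^ i) w"] pow[OF w(1)] W
    unfolding vecs_def by blast
  define p where "p = (\<Sum>i\<le>S. monom (c i) i)"
  have cp: "coeff p i = (if i \<le> S then c i else 0)" for i
    by (simp add: p_def coeff_sum if_distrib cong: if_cong)
  have "degree p \<le> S"
    by (rule degree_le) (simp add: cp)
  then have "pmv S A p w = (\<Sum>i\<le>S. scale_fun (c i) ((mv S A ^^ i) w))"
    unfolding pmv_eq[OF \<open>degree p \<le> S\<close>] by (intro sum.cong) (auto simp: cp)
  also have "\<dots> = 0"
    by (simp add: fun_eq_iff fun_apply c(2))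
  finally have "pmv S A p w = 0" .
  moreover have "p \<noteq> 0"
    using c(1) cp by (metis coeff_0)
  ultimately have ex: "\<exists>n. P n"
    using w by (auto simp: P_def)
  define n where "n = (LEAST n. P n)"
  have "P n" unfolding n_def using ex by (rule LeastI_ex)
  then obtain p u where p: "p \<noteq> 0" "degree p = n" and u: "u \<in> W" "u \<noteq> 0" "pmv S A p u = 0"
    by (auto simp: P_def)
  have "degree p \<noteq> 0"
  proof
    assume d: "degree p = 0"
    then have "scale_fun (coeff p 0) u = 0"
      using u(3) by (simp add: pmv_def)
    moreover have "coeff p 0 \<noteq> 0"
      using p(1) d leading_coeff_0_iff[of p] by simp
    ultimately show False using u(2) by simp
  qed
  then have "\<not> constant (poly p)"
    by (simp add: constant_degree)
  then obtain z where "poly p z = 0"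
    using fundamental_theorem_of_algebra by blast
  then obtain q where q: "p = [:- z, 1:] * q"
    by (auto simp: poly_eq_0_iff_dvd elim: dvdE)
  have q0: "q \<noteq> 0" using p(1) q by auto
  have "degree p = degree [:- z, 1:] + degree q"
    unfolding q using q0 by (intro degree_mult_eq) auto
  then have "degree q < n"
    using p(2) by simp
  then have "\<not> P (degree q)"
    unfolding n_def by (rule not_less_Least)
  then have nz: "pmv S A q u \<noteq> 0"
    using q0 u by (auto simp: P_def)
  have "mv S A (pmv S A q u) = scale_fun z (pmv S A q u)"
    using u(3) unfolding q pmv_linear_factor by simp
  with that pmvW[OF u(1)] nz show ?thesis by blast
qed

text \<open>Requiring $W$ to be invariant under the adjoints as well lets eigenspaces of one matrix
  inherit the hypothesis without knowing that the matrices commute with each other.\<close>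
lemma joint_eigenvector:
  fixes T :: "'i \<Rightarrow> nat \<Rightarrow> nat \<Rightarrow> complex" and W :: "(nat \<Rightarrow> complex) set"
  assumes comm: "\<And>i j u. mv S (adj (T j)) (mv S (T i) u) = mv S (T i) (mv S (adj (T j)) u)"
    and "finite F"
    and "cfun.subspace W" "W \<subseteq> vecs S"
    and "\<And>i u. u \<in> W \<Longrightarrow> mv S (T i) u \<in> W" "\<And>i u. u \<in> W \<Longrightarrow> mv S (adj (T i)) u \<in> W"
    and "w \<in> W" "w \<noteq> 0"
  shows "\<exists>u\<in>W. u \<noteq> 0 \<and> (\<forall>i\<in>F. \<exists>c. mv S (T i) u = scale_fun c u)"
  using assms(2-)
proof (induction F arbitrary: W w rule: finite_induct)
  case empty
  then show ?case by auto
next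
  case (insert i F)
  note sub = insert.prems(1) and W = insert.prems(2) and inv = insert.prems(3,4)
  obtain u c where u: "u \<in> W" "u \<noteq> 0" "mv S (T i) u = scale_fun c u"
    using ex_eigenvector[OF sub W inv(1) insert.prems(5,6)] by metis
  define W' where "W' = {v \<in> W. mv S (T i) v = scale_fun c v}"
  have adjW: "mv S (adj (T i)) v = scale_fun (cnj c) v" if "v \<in> W'" for v
    using that W comm by (intro normal_eigenvector_adj) (auto simp: W'_def)
  have sub': "cfun.subspace W'"
    using sub by (auto simp: cfun.subspace_def W'_def mv_add mv_scale cfun.scale_right_distrib mult.commute)
  have inv1: "mv S (T j) v \<in> W'" if "v \<in> W'" for j v
  proof -
    \<comment> \<open>\<open>T j\<close> is known to commute with the adjoint of \<open>T i\<close>,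
      so the eigenvalue equation is passed to the adjoint, transported along \<open>T j\<close>, and
      brought back by normality.\<close>
    have "mv S (adj (T i)) (mv S (T j) v) = scale_fun (cnj c) (mv S (T j) v)"
      using adjW[OF that] by (simp add: comm mv_scale)
    then have "mv S (T i) (mv S (T j) v) = scale_fun c (mv S (T j) v)"
      using normal_eigenvector_adj[of S "adj (T i)" "mv S (T j) v" "cnj c"] comm[of i i] by simp
    then show ?thesis
      using that inv(1) by (simp add: W'_def)
  qed
  have inv2: "mv S (adj (T j)) v \<in> W'" if "v \<in> W'" for j v
    using that inv(2) by (auto simp: W'_def comm[symmetric] mv_scale)
  have "\<exists>u\<in>W'. u \<noteq> 0 \<and> (\<forall>i\<in>F. \<exists>c. mv S (T i) u = scale_fun c u)"
    using insert.IH[OF sub' _ inv1 inv2, of u] u W by (auto simp: W'_def)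
  then show ?case by (auto simp: W'_def)
qed

lemma expansion_residual_orthogonal:
  fixes E :: "nat \<Rightarrow> nat \<Rightarrow> complex"
  assumes "\<And>k l. k < r \<Longrightarrow> l < r \<Longrightarrow> ip S (E k) (E l) = (if k = l then 1 else 0)" and "k < r"
  shows "ip S (E k) (u - (\<Sum>l<r. scale_fun (ip S (E l) u) (E l))) = 0"
proof -
  have "(\<Sum>l<r. ip S (E l) u * ip S (E k) (E l)) = (\<Sum>l<r. if l = k then ip S (E l) u else 0)"
    using assms by (intro sum.cong) auto
  then show ?thesis
    using assms(2) by (simp add: ip_simps ip_sum_right)
qed

text \<open>Double counting the entries of the \<open>E l\<close> shows that the squared residuals
  of the unit vectors sum to \<open>S - r\<close>. This is nonnegative in general, and zero when
  every vector equals its expansion.\<close>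

lemma bessel_size:
  fixes E :: "nat \<Rightarrow> nat \<Rightarrow> complex"
  assumes on: "\<And>k l. k < r \<Longrightarrow> l < r \<Longrightarrow> ip S (E k) (E l) = (if k = l then 1 else 0)"
  shows "r \<le> S"
    and "(\<And>u. u \<in> vecs S \<Longrightarrow> u = (\<Sum>l<r. scale_fun (ip S (E l) u) (E l))) \<Longrightarrow> r = S"
proof -
  define \<delta> where "\<delta> q = (\<lambda>s::nat. if s = q then 1 else (0::complex))" for q
  have ip\<delta>: "ip S u (\<delta> q) = cnj (u q)" "ip S (\<delta> q) u = u q" if "q < S" for u q
    using that by (simp_all add: ip_def \<delta>_def if_distrib[of cnj] if_distrib[of "\<lambda>x. x * _"]
        if_distrib[of "\<lambda>x. _ * x"] cong: if_cong)
  define res where "res q = \<delta> q - (\<Sum>l<r. scale_fun (ip S (E l) (\<delta> q)) (E l))" for q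
  have res: "ip S (res q) (res q) = 1 - (\<Sum>l<r. E l q * cnj (E l q))" if q: "q < S" for q
  proof -
    have 0: "ip S (E k) (res q) = 0" if "k < r" for k
      unfolding res_def by (rule expansion_residual_orthogonal[OF on that])
    have "ip S (res q) (res q) = ip S (\<delta> q) (res q)"
      by (subst (1) res_def) (simp add: ip_simps ip_sum_left 0)
    also have "\<dots> = 1 - (\<Sum>l<r. E l q * cnj (E l q))"
      unfolding ip\<delta>(2)[OF q] by (simp add: res_def ip\<delta>(1)[OF q] mult.commute) (simp add: \<delta>_def fun_apply mult.commute)
    finally show ?thesis .
  qed
  have "(\<Sum>q<S. ip S (res q) (res q)) = of_nat S - (\<Sum>q<S. \<Sum>l<r. E l q * cnj (E l q))"
    by (simp add: res sum_subtractf)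
  also have "(\<Sum>q<S. \<Sum>l<r. E l q * cnj (E l q)) = (\<Sum>l<r. ip S (E l) (E l))"
    by (subst sum.swap) (simp add: ip_def mult.commute)
  also have "\<dots> = of_nat r"
    by (simp add: on)
  finally have eq: "(\<Sum>q<S. ip S (res q) (res q)) = of_nat S - of_nat r" .
  have "0 \<le> Re (\<Sum>q<S. ip S (res q) (res q))"
    unfolding ip_self by (simp add: sum_nonneg)
  then show "r \<le> S" unfolding eq by simp
  show "r = S" if *: "\<And>u. u \<in> vecs S \<Longrightarrow> u = (\<Sum>l<r. scale_fun (ip S (E l) u) (E l))"
  proof -
    have "res q = 0" if "q < S" for q
    proof -
      have "\<delta> q \<in> vecs S" using that by (auto simp: \<delta>_def vecs_def)
      from *[OF this] show ?thesis unfolding res_def by simp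
    qed
    then have "of_nat S - of_nat r = (0::complex)"
      unfolding eq[symmetric] by simp
    then show ?thesis by simp
  qed
qed

text \<open>Take a longest orthonormal family of joint eigenvectors. By normality its members are
  eigenvectors of the adjoints too, so its orthogonal complement is invariant under all
  \<open>T i\<close> and their adjoints. A nonzero complement would contain a further joint
  eigenvector; hence it is zero, the family expands every vector, and its length is
  \<open>S\<close>.\<close>

theorem joint_orthonormal_eigenbasis:
  fixes T :: "'i::finite \<Rightarrow> nat \<Rightarrow> nat \<Rightarrow> complex"
  assumes comm: "\<And>i j u. mv S (adj (T j)) (mv S (T i) u) = mv S (T i) (mv S (adj (T j)) u)"
  obtains E :: "nat \<Rightarrow> nat \<Rightarrow> complex" and z :: "nat \<Rightarrow> 'i \<Rightarrow> complex" where
    "\<And>k. k < S \<Longrightarrow> E k \<in> vecs S"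
    "\<And>k l. k < S \<Longrightarrow> l < S \<Longrightarrow> ip S (E k) (E l) = (if k = l then 1 else 0)"
    "\<And>k i. k < S \<Longrightarrow> mv S (T i) (E k) = scale_fun (z k i) (E k)"
    "\<And>u. u \<in> vecs S \<Longrightarrow> u = (\<Sum>l<S. scale_fun (ip S (E l) u) (E l))"
proof -
  define Q where "Q r E \<longleftrightarrow> (\<forall>k<r. E k \<in> vecs S) \<and>
    (\<forall>k<r. \<forall>l<r. ip S (E k) (E l) = (if k = l then 1 else 0)) \<and>
    (\<forall>k<r. \<forall>i. \<exists>c. mv S (T i) (E k) = scale_fun c (E k))" for r :: nat and E :: "nat \<Rightarrow> nat \<Rightarrow> complex"
  define P where "P r \<longleftrightarrow> (\<exists>E. Q r E)" for r
  have P0: "P 0" by (simp add: P_def Q_def)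
  have bd: "\<forall>r. P r \<longrightarrow> r \<le> S"
  proof (intro allI impI)
    fix r assume "P r"
    then obtain E where "Q r E" by (auto simp: P_def)
    then show "r \<le> S" by (intro bessel_size(1)[of r S E]) (simp add: Q_def)
  qed
  define r where "r = (GREATEST r. P r)"
  have "P r" unfolding r_def using GreatestI_nat[of P 0 S] P0 bd by blast
  then obtain E where E: "Q r E" by (auto simp: P_def)
  have max: "\<not> P (Suc r)"
    using Greatest_le_nat[of P "Suc r" S] bd unfolding r_def by auto
  have on: "ip S (E k) (E l) = (if k = l then 1 else 0)" if "k < r" "l < r" for k l
    using E that by (simp add: Q_def)
  have EV: "E k \<in> vecs S" if "k < r" for k
    using E that by (simp add: Q_def)
  have eig: "\<exists>c. mv S (T i) (E k) = scale_fun c (E k)" if "k < r" for i k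
    using E that by (simp add: Q_def)
  define W where "W = {u \<in> vecs S. \<forall>k<r. ip S (E k) u = 0}"
  have W0: "W = {0}"
  proof (rule ccontr)
    have sub: "cfun.subspace W"
      by (auto simp: cfun.subspace_def W_def vecs_def ip_simps fun_apply)
    assume "W \<noteq> {0}"
    then obtain w where w: "w \<in> W" "w \<noteq> 0"
      using cfun.subspace_0[OF sub] by auto
    have inv1: "mv S (T i) u \<in> W" if "u \<in> W" for i u
      unfolding W_def
    proof (safe intro!: mv_vecs)
      fix k assume k: "k < r"
      obtain c where c: "mv S (T i) (E k) = scale_fun c (E k)" using eig[OF k] by blast
      have "mv S (adj (T i)) (E k) = scale_fun (cnj c) (E k)"
        using comm EV[OF k] c by (intro normal_eigenvector_adj) auto
      then show "ip S (E k) (mv S (T i) u) = 0"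
        using that k by (simp add: ip_mv_right ip_simps W_def)
    qed
    have inv2: "mv S (adj (T i)) u \<in> W" if "u \<in> W" for i u
      unfolding W_def
    proof (safe intro!: mv_vecs)
      fix k assume k: "k < r"
      obtain c where c: "mv S (T i) (E k) = scale_fun c (E k)" using eig[OF k] by blast
      then show "ip S (E k) (mv S (adj (T i)) u) = 0"
        using that k by (simp add: ip_mv_right ip_simps W_def)
    qed
    obtain u where u: "u \<in> W" "u \<noteq> 0" "\<And>i. \<exists>c. mv S (T i) u = scale_fun c u"
      using joint_eigenvector[of S T UNIV W w, OF comm _ sub _ inv1 inv2 w] by (auto simp: W_def)
    define h where "h = sqrt (\<Sum>s<S. (cmod (u s))\<^sup>2)"
    have uV: "u \<in> vecs S" using u(1) by (simp add: W_def)
    have ipu: "ip S u u = complex_of_real (h\<^sup>2)"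
      unfolding ip_self h_def by (simp add: sum_nonneg)
    then have h: "h \<noteq> 0"
      using ip_self_eq_0[OF uV] u(2) by auto
    define E' where "E' k = (if k = r then scale_fun (complex_of_real (1 / h)) u else E k)" for k
    have "Q (Suc r) E'"
      unfolding Q_def
    proof (intro conjI allI impI)
      show "E' k \<in> vecs S" if "k < Suc r" for k
        using that EV uV by (auto simp: E'_def vecs_def less_Suc_eq fun_apply)
      show "\<exists>c. mv S (T i) (E' k) = scale_fun c (E' k)" if "k < Suc r" for i k
      proof (cases "k = r")
        case True
        obtain c where "mv S (T i) u = scale_fun c u" using u(3) by blast
        then show ?thesis
          using True by (intro exI[of _ c]) (simp add: E'_def mv_scale mult.commute)
      qed (use that eig in \<open>simp add: E'_def\<close>)
      show "ip S (E' k) (E' l) = (if k = l then 1 else 0)" if kl: "k < Suc r" "l < Suc r" for k l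
      proof -
        have 0: "ip S (E k) u = 0" "ip S u (E k) = 0" if "k < r" for k
          using u(1) that cnj_ip[of S "E k" u] by (auto simp: W_def)
        consider "k = r" "l = r" | "k = r" "l < r" | "k < r" "l = r" | "k < r" "l < r"
          using kl by linarith
        then show ?thesis
        proof cases
          case 1
          have "complex_of_real (1 / h) * (complex_of_real (1 / h) * complex_of_real (h\<^sup>2)) = 1"
            unfolding of_real_mult[symmetric] using h by (simp add: power2_eq_square)
          then show ?thesis
            using 1 by (simp add: E'_def ip_simps ipu del: of_real_divide of_real_power)
        qed (simp_all add: E'_def ip_simps 0 on)
      qed
    qed
    then show False using max by (auto simp: P_def)
  qed
  have exp: "u = (\<Sum>l<r. scale_fun (ip S (E l) u) (E l))" if "u \<in> vecs S" for u
  proof -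
    define res where "res = u - (\<Sum>l<r. scale_fun (ip S (E l) u) (E l))"
    have "ip S (E k) res = 0" if "k < r" for k
      unfolding res_def by (rule expansion_residual_orthogonal[OF on that])
    moreover have "res \<in> vecs S"
      using that EV by (simp add: res_def vecs_def fun_apply)
    ultimately have "res \<in> W" by (simp add: W_def)
    then show ?thesis using W0 by (simp add: res_def)
  qed
  have r: "r = S"
    by (rule bessel_size(2)[OF on exp])
  have "\<forall>k i. \<exists>c. k < S \<longrightarrow> mv S (T i) (E k) = scale_fun c (E k)"
    using eig r by blast
  then obtain z where z: "\<And>k i. k < S \<Longrightarrow> mv S (T i) (E k) = scale_fun (z k i) (E k)"
    by metis
  show ?thesis
    using that[of E z] EV on exp z r by simp
qed

lemma ip_mv_mv:
  "ip S (mv S A u) (mv S B v) = (\<Sum>s<S. \<Sum>q<S. cnj (u s) * (\<Sum>r<S. cnj (A r s) * B r q) * v q)"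
proof -
  have "ip S (mv S A u) (mv S B v)
      = (\<Sum>r<S. \<Sum>s<S. \<Sum>q<S. cnj (u s) * (cnj (A r s) * B r q) * v q)"
    by (simp add: ip_def mv_def cnj_sum sum_product) (simp add: mult_ac)
  also have "\<dots> = (\<Sum>s<S. \<Sum>q<S. \<Sum>r<S. cnj (u s) * (cnj (A r s) * B r q) * v q)"
    by (rule trans[OF sum.swap], rule sum.cong[OF refl], rule sum.swap)
  finally show ?thesis
    by (simp add: sum_distrib_left sum_distrib_right)
qed

text \<open>Choosing the first component $U_0 = -\sum_p A_p^* U_p$ turns the block matrix into its Schur
  complement, whose diagonal blocks are the self-commutators of the $A_p$; these have trace zero, so
  the whole Schur complement vanishes.\<close>
lemma block_psd_imp_commute:
  fixes A :: "nat \<Rightarrow> nat \<Rightarrow> nat \<Rightarrow> complex" and S n :: nat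
  defines "X \<equiv> case_nat (\<lambda>u. u) (\<lambda>p. mv S (A p))"
  assumes nonneg: "\<And>U. (\<And>p. U p \<in> vecs S) \<Longrightarrow>
      0 \<le> Re (\<Sum>p<Suc n. \<Sum>q<Suc n. ip S (X q (U p)) (X p (U q)))"
    and pq: "p < n" "q < n"
  shows "mv S (adj (A q)) (mv S (A p) u) = mv S (A p) (mv S (adj (A q)) u)"
proof -
  \<comment> \<open>Block (p, q) holds the entries of \<open>adj (A q)\<close> times
    \<open>A p\<close> minus \<open>A p\<close> times \<open>adj (A q)\<close>; pairs (block, row)
    serve as indices so that all blocks form one matrix with one trace.\<close>
  define H where "H a b = (\<Sum>r<S. cnj (A (fst b) r (snd a)) * A (fst a) r (snd b))
      - (\<Sum>r<S. A (fst a) (snd a) r * cnj (A (fst b) (snd b) r))" for a b :: "nat \<times> nat"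
  define I where "I = {..<n} \<times> {..<S}"
  have "hermitian_psd I H"
    unfolding hermitian_psd_def
  proof (intro conjI ballI allI)
    show "cnj (H a b) = H b a" for a b
      by (simp add: H_def cnj_sum mult.commute)
    fix v :: "nat \<times> nat \<Rightarrow> complex"
    define U where "U p = (\<lambda>s. if s < S then v (p, s) else 0)" for p
    define N where "N = (\<Sum>p<n. mv S (adj (A p)) (U p))"
    have N: "N \<in> vecs S"
      using mv_vecs by (auto simp: N_def vecs_def sum_fun_apply)
    have 1: "(\<Sum>s<S. \<Sum>q'<S. cnj (v (p, s)) * H (p, s) (q, q') * v (q, q'))
        = ip S (mv S (A q) (U p)) (mv S (A p) (U q)) - ip S (mv S (adj (A p)) (U p)) (mv S (adj (A q)) (U q))"
      for p q
      unfolding ip_mv_mv sum_subtractf[symmetric]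
      by (intro sum.cong refl) (simp add: H_def U_def adj_def algebra_simps)
    have "(\<Sum>a\<in>I. \<Sum>b\<in>I. cnj (v a) * H a b * v b)
        = (\<Sum>p<n. \<Sum>s<S. \<Sum>q<n. \<Sum>q'<S. cnj (v (p, s)) * H (p, s) (q, q') * v (q, q'))"
      unfolding I_def by (simp add: sum.cartesian_product')
    also have "\<dots> = (\<Sum>p<n. \<Sum>q<n. \<Sum>s<S. \<Sum>q'<S. cnj (v (p, s)) * H (p, s) (q, q') * v (q, q'))"
      by (rule sum.cong[OF refl], rule sum.swap)
    also have "\<dots> = (\<Sum>p<n. \<Sum>q<n. ip S (mv S (A q) (U p)) (mv S (A p) (U q))) - ip S N N"
      by (simp add: 1 sum_subtractf N_def ip_sum_left ip_sum_right)
         (rule sum.swap)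
    finally have form: "(\<Sum>a\<in>I. \<Sum>b\<in>I. cnj (v a) * H a b * v b)
        = (\<Sum>p<n. \<Sum>q<n. ip S (mv S (A q) (U p)) (mv S (A p) (U q))) - ip S N N" .
    define U' where "U' = case_nat (- N) U"
    have "U' p \<in> vecs S" for p
      using N by (auto simp: U'_def U_def vecs_def fun_apply split: nat.split)
    from nonneg[OF this] have "0 \<le> Re (\<Sum>p<Suc n. \<Sum>q<Suc n. ip S (X q (U' p)) (X p (U' q)))" .
    also have "(\<Sum>p<Suc n. \<Sum>q<Suc n. ip S (X q (U' p)) (X p (U' q)))
        = ip S N N - (\<Sum>q<n. ip S N (mv S (adj (A q)) (U q))) - (\<Sum>p<n. ip S (mv S (adj (A p)) (U p)) N)
          + (\<Sum>p<n. \<Sum>q<n. ip S (mv S (A q) (U p)) (mv S (A p) (U q)))"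
      unfolding sum.lessThan_Suc_shift
      by (simp add: X_def U'_def mv_minus ip_simps ip_mv_left[of S _ N] ip_mv_right[of S _ _ N]
          sum.distrib sum_negf sum_subtractf del: sum.lessThan_Suc)
    also have "(\<Sum>q<n. ip S N (mv S (adj (A q)) (U q))) = ip S N N"
      by (simp add: N_def ip_sum_right)
    also have "(\<Sum>p<n. ip S (mv S (adj (A p)) (U p)) N) = ip S N N"
      by (simp add: N_def ip_sum_left)
    finally show "0 \<le> Re (\<Sum>a\<in>I. \<Sum>b\<in>I. cnj (v a) * H a b * v b)"
      unfolding form by simp
  qed
  moreover have "(\<Sum>a\<in>I. H a a) = 0"
  proof -
    have "(\<Sum>s<S. H (p, s) (p, s)) = 0" for p
      by (simp add: H_def sum_subtractf mult.commute) (rule sum.swap)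
    then show ?thesis
      by (simp add: I_def sum.cartesian_product')
  qed
  ultimately have "H (p, s) (q, s') = 0" if "s < S" "s' < S" for s s'
    by (intro hermitian_psd_zero_trace[of I H]) (use that pq in \<open>auto simp: I_def\<close>)
  then show ?thesis
    by (intro mv_commute) (simp add: H_def adj_def)
qed

section \<open>Multi-indices and polynomials\<close>

text \<open>Stated with \<open>Suc 0\<close>, the form to which the simplifier rewrites the
  \<open>1\<close> in \<open>zvar\<close> and \<open>zbar\<close>.\<close>

abbreviation unit_idx :: "'n \<Rightarrow> 'n mindex" where
  "unit_idx i \<equiv> Poly_Mapping.single i (Suc 0)"

lemma mdeg_add: "mdeg (\<alpha> + \<beta>) = mdeg \<alpha> + mdeg \<beta>"
  by (simp add: mdeg_def lookup_add sum.distrib)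

lemma mdeg_0 [simp]: "mdeg 0 = 0"
  by (simp add: mdeg_def)

lemma mdeg_single [simp]: "mdeg (Poly_Mapping.single i k) = k"
  by (simp add: mdeg_def lookup_single when_def)

lemma finite_mindices [simp]: "finite (mindices t :: 'n::finite mindex set)"
proof (rule finite_imageD)
  have "Poly_Mapping.lookup ` (mindices t :: 'n mindex set) \<subseteq> Pi UNIV (\<lambda>_. {..t})"
  proof (safe; simp)
    fix \<alpha> :: "'n mindex" and i
    assume "\<alpha> \<in> mindices t"
    moreover have "Poly_Mapping.lookup \<alpha> i \<le> mdeg \<alpha>"
      unfolding mdeg_def by (rule member_le_sum) auto
    ultimately show "Poly_Mapping.lookup \<alpha> i \<le> t" by (simp add: mindices_def)
  qed
  moreover have "finite (Pi UNIV (\<lambda>_. {..t}) :: ('n \<Rightarrow> nat) set)"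
    using finite_PiE[of "UNIV :: 'n set" "\<lambda>_. {..t}"] by (simp add: PiE_def)
  ultimately show "finite (Poly_Mapping.lookup ` (mindices t :: 'n mindex set))"
    by (rule finite_subset)
  show "inj_on Poly_Mapping.lookup (mindices t :: 'n mindex set)"
    by (simp add: inj_on_def lookup_inject)
qed

lemma mindices_mono: "s \<le> t \<Longrightarrow> mindices s \<subseteq> mindices t"
  by (auto simp: mindices_def)

lemma mindex_decompose:
  fixes \<alpha> :: "'n::finite mindex"
  assumes "\<alpha> \<noteq> 0"
  obtains \<beta> i where "\<alpha> = \<beta> + unit_idx i" "mdeg \<alpha> = Suc (mdeg \<beta>)"
proof -
  obtain i where i: "Poly_Mapping.lookup \<alpha> i \<noteq> 0"
    using assms by (metis lookup_zero poly_mapping_eqI)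
  have "\<alpha> = (\<alpha> - unit_idx i) + unit_idx i"
    using i by (intro poly_mapping_eqI) (auto simp: lookup_add lookup_minus lookup_single when_def)
  with that mdeg_add[of "\<alpha> - unit_idx i" "unit_idx i"] show ?thesis by auto
qed

lemma mpow_0 [simp]: "mpow z 0 = 1"
  by (simp add: mpow_def)

lemma mpow_add: "mpow z (\<alpha> + \<beta>) = mpow z \<alpha> * mpow z \<beta>"
  by (simp add: mpow_def lookup_add power_add prod.distrib)

lemma mpow_single [simp]: "mpow z (Poly_Mapping.single i k) = (z $ i) ^ k"
proof -
  have "mpow z (Poly_Mapping.single i k) = (\<Prod>j\<in>UNIV. if j = i then (z $ j) ^ k else 1)"
    unfolding mpow_def by (intro prod.cong) (auto simp: lookup_single when_def)
  then show ?thesis by simp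
qed

section \<open>The Riesz functional and moment matrices\<close>

lemma riesz_superset:
  assumes "finite A" "Poly_Mapping.keys \<phi> \<subseteq> A"
  shows "riesz y \<phi> = (\<Sum>p\<in>A. Poly_Mapping.lookup \<phi> p * y (fst p) (snd p))"
  unfolding riesz_def case_prod_unfold using assms
  by (intro sum.mono_neutral_cong_left) (auto simp: in_keys_iff)

lemma riesz_diff: "riesz y (\<phi> - \<psi>) = riesz y \<phi> - riesz y \<psi>"
proof -
  let ?A = "Poly_Mapping.keys \<phi> \<union> Poly_Mapping.keys \<psi>"
  have "Poly_Mapping.keys (\<phi> - \<psi>) \<subseteq> ?A"
    by (auto simp: in_keys_iff lookup_minus)
  then show ?thesis
    by (subst (1 2 3) riesz_superset[where A = ?A])
       (auto simp: lookup_minus algebra_simps sum_subtractf)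
qed

lemma riesz_0 [simp]: "riesz y 0 = 0"
  by (simp add: riesz_def)

lemma riesz_uminus: "riesz y (- \<phi>) = - riesz y \<phi>"
  using riesz_diff[of y 0 \<phi>] by simp

lemma riesz_add: "riesz y (\<phi> + \<psi>) = riesz y \<phi> + riesz y \<psi>"
  using riesz_diff[of y \<phi> "- \<psi>"] by (simp add: riesz_uminus)

lemma riesz_sum: "riesz y (\<Sum>i\<in>A. \<phi> i) = (\<Sum>i\<in>A. riesz y (\<phi> i))"
  by (induction A rule: infinite_finite_induct) (simp_all add: riesz_add)

lemma riesz_single: "riesz y (Poly_Mapping.single (\<alpha>, \<beta>) c) = c * y \<alpha> \<beta>"
  by (simp add: riesz_def)

lemma cmonom_mult: "cmonom \<alpha> \<beta> * cmonom \<gamma> \<delta> = cmonom (\<alpha> + \<gamma>) (\<beta> + \<delta>)"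
  by (simp add: cmonom_def mult_single)

lemma moment_mat_cmonom: "moment_mat (cmonom \<gamma> \<delta>) y \<alpha> \<beta> = y (\<alpha> + \<gamma>) (\<beta> + \<delta>)"
  by (simp add: moment_mat_def cmonom_mult) (simp add: cmonom_def riesz_single add.commute)

lemma moment_mat_0_0: "moment_mat \<phi> y 0 0 = riesz y \<phi>"
  by (simp add: moment_mat_eq_sum riesz_def)

lemma moment_mat_uminus: "moment_mat (- \<phi>) y \<alpha> \<beta> = - moment_mat \<phi> y \<alpha> \<beta>"
  by (simp add: moment_mat_def riesz_uminus)

lemma moment_mat_sphere:
  "moment_mat (sphere_poly R) y \<alpha> \<beta>
    = complex_of_real (R\<^sup>2) * y \<alpha> \<beta> - (\<Sum>j\<in>UNIV. y (\<alpha> + unit_idx j) (\<beta> + unit_idx j))"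
proof -
  have "Poly_Mapping.single 0 c * cmonom \<alpha> \<beta> = Poly_Mapping.single (\<alpha>, \<beta>) c" for c
    by (simp add: cmonom_def mult_single)
  then show ?thesis
    unfolding moment_mat_def sphere_poly_def left_diff_distrib sum_distrib_right riesz_diff riesz_sum
    by (simp add: riesz_single zbar_def zvar_def cmonom_mult)
       (simp add: cmonom_def riesz_single add.commute)
qed

lemma lookup_sphere_poly:
  "Poly_Mapping.lookup (sphere_poly R) (\<alpha>, \<beta>) = (if \<alpha> = 0 \<and> \<beta> = 0 then complex_of_real (R\<^sup>2) else 0)
    - (\<Sum>j\<in>UNIV. if \<alpha> = unit_idx j \<and> \<beta> = unit_idx j then 1 else 0)"
  by (simp add: sphere_poly_def lookup_minus lookup_sum zbar_def zvar_def cmonom_mult)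
     (auto simp: cmonom_def lookup_single when_def zero_prod_def intro!: sum.cong)

lemma unit_idx_eq_iff: "unit_idx i = unit_idx j \<longleftrightarrow> i = j"
  by (metis lookup_single_eq lookup_single_not_eq nat.distinct(1))

text \<open>Fixes the order of the sphere localizing matrices at \<open>d - 1\<close> and makes d_K
  at least 1, so that t - d_K is strictly below t.\<close>

lemma has_cdegree_sphere_poly:
  assumes "has_cdegree \<phi> l" "\<phi> = sphere_poly R \<or> \<phi> = - sphere_poly (R :: real)"
  shows "l = 1"
proof (rule antisym)
  obtain \<alpha> \<beta> where ab: "mdeg \<alpha> = l" "Poly_Mapping.lookup \<phi> (\<alpha>, \<beta>) \<noteq> 0"
    using assms(1) by (auto simp: has_cdegree_def)
  then have nz: "Poly_Mapping.lookup (sphere_poly R) (\<alpha>, \<beta>) \<noteq> 0"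
    using assms(2) by auto
  have "\<alpha> = 0 \<or> (\<exists>j. \<alpha> = unit_idx j)"
  proof (rule ccontr)
    assume "\<not> ?thesis"
    then have "Poly_Mapping.lookup (sphere_poly R) (\<alpha>, \<beta>) = 0"
      by (simp add: lookup_sphere_poly)
    with nz show False by simp
  qed
  then show "l \<le> 1" using ab(1) by auto
  \<comment> \<open>Types are inhabited, so some variable exists; its square term has coefficient -1
    or 1 in \<open>\<phi>\<close>.\<close>
  fix j :: 'a
  have "Poly_Mapping.lookup (sphere_poly R) (unit_idx j, unit_idx j) = - 1"
    by (simp add: lookup_sphere_poly unit_idx_eq_iff)
       (metis mdeg_0 mdeg_single nat.distinct(1))
  then have "(unit_idx j, unit_idx j) \<in> Poly_Mapping.keys \<phi>"
    using assms(2) by (auto simp: in_keys_iff)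
  then have "mdeg (unit_idx j) \<le> l"
    using assms(1) by (fastforce simp: has_cdegree_def real_cpolys_def)
  then show "1 \<le> l" by simp
qed

text \<open>The shifts cross over: the block row \<open>p\<close> moves the z index, the block
  column \<open>q\<close> moves the zbar index. In Gram vectors the entry is the inner product of
  \<open>x (\<alpha> + h q)\<close> with \<open>x (\<beta> + h p)\<close>, which is why the
  operators appear as an adjoint of \<open>q\<close> times \<open>p\<close>.\<close>

lemma shift_block_mat_eq:
  assumes "p < 3" "q < 3" "h = (\<lambda>p::nat. if p = 0 then 0 else if p = 1 then unit_idx i else unit_idx j)"
  shows "shift_block_mat i j y (p, \<alpha>) (q, \<beta>) = y (\<alpha> + h q) (\<beta> + h p)"
proof -
  have 1: "1 = cmonom 0 0"
    by (simp add: cmonom_def flip: zero_prod_def)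
  have "p = 0 \<or> p = 1 \<or> p = 2" "q = 0 \<or> q = 1 \<or> q = 2" using assms by auto
  then show ?thesis
    by (elim disjE) (simp_all add: shift_block_mat_def assms(3) 1 zvar_def zbar_def cmonom_mult moment_mat_cmonom)
qed

text \<open>The bound \<open>s + l \<le> t\<close> keeps every index shifted by a monomial of
  \<open>\<phi>\<close> in the range where the atoms represent \<open>y\<close>.\<close>

lemma moment_mat_atomic:
  assumes y: "\<And>\<alpha> \<beta>. \<alpha> \<in> mindices t \<Longrightarrow> \<beta> \<in> mindices t \<Longrightarrow>
      y \<alpha> \<beta> = (\<Sum>k<r. complex_of_real (w k) * cnj (mpow (\<zeta> k) \<alpha>) * mpow (\<zeta> k) \<beta>)"
    and deg: "\<And>\<gamma> \<delta>. (\<gamma>, \<delta>) \<in> Poly_Mapping.keys \<phi> \<Longrightarrow> mdeg \<gamma> \<le> l \<and> mdeg \<delta> \<le> l"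
    and ab: "\<alpha> \<in> mindices s" "\<beta> \<in> mindices s" and st: "s + l \<le> t"
  shows "moment_mat \<phi> y \<alpha> \<beta>
    = (\<Sum>k<r. complex_of_real (w k) * ceval \<phi> (\<zeta> k) * cnj (mpow (\<zeta> k) \<alpha>) * mpow (\<zeta> k) \<beta>)"
proof -
  have "moment_mat \<phi> y \<alpha> \<beta> = (\<Sum>p\<in>Poly_Mapping.keys \<phi>. \<Sum>k<r. Poly_Mapping.lookup \<phi> p *
      (complex_of_real (w k) * cnj (mpow (\<zeta> k) (\<alpha> + fst p)) * mpow (\<zeta> k) (\<beta> + snd p)))"
    unfolding moment_mat_eq_sum case_prod_unfold
  proof (rule sum.cong[OF refl])
    fix p assume "p \<in> Poly_Mapping.keys \<phi>"
    with deg[of "fst p" "snd p"] ab st have "\<alpha> + fst p \<in> mindices t" "\<beta> + snd p \<in> mindices t"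
      by (auto simp: mindices_def mdeg_add)
    then show "Poly_Mapping.lookup \<phi> (fst p, snd p) * y (\<alpha> + fst p) (\<beta> + snd p)
        = (\<Sum>k<r. Poly_Mapping.lookup \<phi> p *
            (complex_of_real (w k) * cnj (mpow (\<zeta> k) (\<alpha> + fst p)) * mpow (\<zeta> k) (\<beta> + snd p)))"
      by (simp add: y sum_distrib_left)
  qed
  also have "\<dots> = (\<Sum>k<r. \<Sum>p\<in>Poly_Mapping.keys \<phi>. Poly_Mapping.lookup \<phi> p *
      (complex_of_real (w k) * cnj (mpow (\<zeta> k) (\<alpha> + fst p)) * mpow (\<zeta> k) (\<beta> + snd p)))"
    by (rule sum.swap)
  finally show ?thesis
    by (simp add: ceval_def case_prod_unfold mpow_add sum_distrib_left sum_distrib_right mult_ac)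
qed

lemma sum_rank_one:
  "(\<Sum>a\<in>I. \<Sum>b\<in>I. cnj (v a) * (c * cnj (f a) * f b) * v b) = c * complex_of_real ((cmod (\<Sum>b\<in>I. v b * f b))\<^sup>2)"
proof -
  have "complex_of_real ((cmod (\<Sum>b\<in>I. v b * f b))\<^sup>2) = cnj (\<Sum>a\<in>I. v a * f a) * (\<Sum>b\<in>I. v b * f b)"
    by (rule trans[OF complex_norm_square mult.commute])
  then show ?thesis
    by (simp add: cnj_sum sum_product sum_distrib_left mult_ac)
qed

section \<open>Atomic representation of the moments\<close>

lemma ip_sum_scale_sum_scale:
  "ip S (\<Sum>a\<in>A. scale_fun (c a) (f a)) (\<Sum>b\<in>B. scale_fun (d b) (g b))
    = (\<Sum>a\<in>A. \<Sum>b\<in>B. cnj (c a) * d b * ip S (f a) (g b))"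
  by (subst ip_sum_left) (simp add: ip_sum_right ip_simps sum_distrib_left mult_ac)

text \<open>The atoms are the joint eigenvalue vectors, and the weights are the squared moduli of
  the coordinates of \<open>x 0\<close>. The rows of \<open>P\<close> are coefficients of
  interpolation polynomials in z of degree at most \<open>s\<close>; they serve later to isolate
  single atoms and to tell them apart.\<close>

lemma atomic_representation:
  fixes y :: "'n::{finite,linorder} mindex \<Rightarrow> 'n mindex \<Rightarrow> complex"
  assumes card: "CARD('n) > 1" and st: "s < t"
    and psd: "hermitian_psd (mindices t) y"
    and rt: "mat_rank (mindices t) y = S" and rs: "mat_rank (mindices s) y = S"
    and sphere: "\<And>\<alpha> \<beta>. \<alpha> \<in> mindices (t - 1) \<Longrightarrow> \<beta> \<in> mindices (t - 1) \<Longrightarrow>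
        (\<Sum>j\<in>UNIV. y (\<alpha> + unit_idx j) (\<beta> + unit_idx j)) = complex_of_real (R\<^sup>2) * y \<alpha> \<beta>"
    and shift: "\<And>i j. i < j \<Longrightarrow> hermitian_psd ({0..<3} \<times> mindices s) (shift_block_mat i j y)"
  obtains \<zeta> :: "nat \<Rightarrow> (complex, 'n) vec" and w :: "nat \<Rightarrow> real" and P :: "nat \<Rightarrow> 'n mindex \<Rightarrow> complex"
  where "\<And>k. k < S \<Longrightarrow> w k > 0"
    and "\<And>\<alpha> \<beta>. \<alpha> \<in> mindices t \<Longrightarrow> \<beta> \<in> mindices t \<Longrightarrow>
        y \<alpha> \<beta> = (\<Sum>k<S. complex_of_real (w k) * cnj (mpow (\<zeta> k) \<alpha>) * mpow (\<zeta> k) \<beta>)"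
    and "\<And>k l. k < S \<Longrightarrow> l < S \<Longrightarrow> (\<Sum>b\<in>mindices s. P k b * mpow (\<zeta> l) b) = (if k = l then 1 else 0)"
proof -
  \<comment> \<open>\<open>?N\<close> is the set from which a shift stays inside \<open>?I\<close>.
    The operators are built from \<open>?J\<close>, but must be shown to act as shifts on all of
    \<open>?N\<close> so that induction on the degree reaches all of \<open>?I\<close>.\<close>
  let ?I = "mindices t :: 'n mindex set" and ?J = "mindices s :: 'n mindex set"
    and ?N = "mindices (t - 1) :: 'n mindex set"
  have JN: "?J \<subseteq> ?N" and NI: "?N \<subseteq> ?I" and JI: "?J \<subseteq> ?I"
    using st by (auto intro!: mindices_mono)
  have NI': "b + unit_idx i \<in> ?I" if "b \<in> ?N" for b i
    using that st by (auto simp: mindices_def mdeg_add)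
  obtain x0 v where x0: "\<And>a b. a \<in> ?I \<Longrightarrow> b \<in> ?I \<Longrightarrow> y a b = (\<Sum>s<S. cnj (x0 a s) * x0 b s)"
    and v0: "\<And>s q. s < S \<Longrightarrow> q < S \<Longrightarrow> (\<Sum>b\<in>?J. v s b * x0 b q) = (if s = q then 1 else 0)"
    apply (rule gram_factorization_rank[OF finite_mindices JI psd rt rs])
    subgoal premises prems for x v
      by (rule prems(1)[of x v]) (rule prems(2,3); assumption)+
    done
  define x where "x a = (\<lambda>q. if q < S then x0 a q else 0)" for a
  have xV: "x a \<in> vecs S" for a by (simp add: x_def vecs_def)
  have gram: "y a b = ip S (x a) (x b)" if "a \<in> ?I" "b \<in> ?I" for a b
    using x0[OF that] by (simp add: ip_def x_def)
  \<comment> \<open>Since \<open>v\<close> is dual to \<open>x0\<close> over \<open>?J\<close>,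
    these coefficients write \<open>u\<close> as a combination of the \<open>x b\<close> with
    \<open>b\<close> in \<open>?J\<close>. The family may be dependent, so \<open>T\<close> rests on
    a choice; \<open>shift_null\<close> shows that the choice does not matter.\<close>
  define cf where "cf u b = (\<Sum>q<S. u q * v q b)" for u b
  define T where "T i = (\<lambda>q r. \<Sum>b\<in>?J. v r b * x (b + unit_idx i) q)" for i
  have recon: "(\<Sum>b\<in>?J. scale_fun (cf u b) (x b)) = u" if "u \<in> vecs S" for u
  proof
    fix q
    show "(\<Sum>b\<in>?J. scale_fun (cf u b) (x b)) q = u q"
    proof (cases "q < S")
      case True
      have "(\<Sum>b\<in>?J. cf u b * x b q) = (\<Sum>r<S. u r * (\<Sum>b\<in>?J. v r b * x0 b q))"
        unfolding cf_def sum_distrib_left sum_distrib_right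
        using True by (subst sum.swap) (simp add: x_def mult.assoc)
      also have "\<dots> = (\<Sum>r<S. if r = q then u r else 0)"
        using v0 True by (intro sum.cong) auto
      finally show ?thesis using True by (simp add: fun_apply)
    next
      case False
      then show ?thesis using that by (simp add: fun_apply x_def vecs_def)
    qed
  qed
  have mvT: "mv S (T i) u = (\<Sum>b\<in>?J. scale_fun (cf u b) (x (b + unit_idx i)))" for i u
  proof
    fix q
    have "(\<Sum>b\<in>?J. cf u b * x (b + unit_idx i) q)
        = (\<Sum>r<S. (\<Sum>b\<in>?J. v r b * x (b + unit_idx i) q) * u r)"
      unfolding cf_def sum_distrib_right by (subst sum.swap) (simp add: mult_ac)
    then show "mv S (T i) u q = (\<Sum>b\<in>?J. scale_fun (cf u b) (x (b + unit_idx i))) q"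
      by (cases "q < S") (simp_all add: mv_def T_def fun_apply, simp add: x_def)
  qed
  have shift_null: "(\<Sum>b\<in>?N. scale_fun (c b) (x (b + unit_idx i))) = 0"
    if c: "(\<Sum>b\<in>?N. scale_fun (c b) (x b)) = 0" for c i
  proof -
    define sh where "sh j = (\<Sum>b\<in>?N. scale_fun (c b) (x (b + unit_idx j)))" for j
    have "(\<Sum>j\<in>UNIV. ip S (sh j) (sh j))
        = (\<Sum>j\<in>UNIV. \<Sum>a\<in>?N. \<Sum>b\<in>?N. cnj (c a) * c b * y (a + unit_idx j) (b + unit_idx j))"
      unfolding sh_def ip_sum_scale_sum_scale by (intro sum.cong refl) (simp add: gram NI')
    also have "\<dots> = (\<Sum>a\<in>?N. \<Sum>b\<in>?N. \<Sum>j\<in>UNIV. cnj (c a) * c b * y (a + unit_idx j) (b + unit_idx j))"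
      by (rule trans[OF sum.swap], rule sum.cong[OF refl], rule sum.swap)
    also have "\<dots> = (\<Sum>a\<in>?N. \<Sum>b\<in>?N. cnj (c a) * c b * (complex_of_real (R\<^sup>2) * ip S (x a) (x b)))"
      using NI by (intro sum.cong refl) (simp add: sum_distrib_left[symmetric] sphere gram subset_iff)
    also have "\<dots> = complex_of_real (R\<^sup>2) * (\<Sum>a\<in>?N. \<Sum>b\<in>?N. cnj (c a) * c b * ip S (x a) (x b))"
      by (simp add: sum_distrib_left mult_ac)
    also have "\<dots> = 0"
      unfolding ip_sum_scale_sum_scale[symmetric] c by simp
    finally have "(\<Sum>j\<in>UNIV. \<Sum>q<S. (cmod (sh j q))\<^sup>2) = 0"
      unfolding ip_self of_real_sum[symmetric] of_real_eq_0_iff .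
    then have "ip S (sh i) (sh i) = 0"
      unfolding ip_self by (simp add: sum_nonneg_eq_0_iff sum_nonneg)
    moreover have "sh i \<in> vecs S"
      using xV by (simp add: sh_def vecs_def fun_apply)
    ultimately show ?thesis
      using ip_self_eq_0 by (simp add: sh_def)
  qed
  have Tx: "mv S (T i) (x b) = x (b + unit_idx i)" if b: "b \<in> ?N" for b i
  proof -
    \<comment> \<open>The relation expressing \<open>x b\<close> through \<open>?J\<close>, written
      as a null combination over \<open>?N\<close>, so that \<open>shift_null\<close> carries it
      over to the shifted vectors.\<close>
    define c where "c a = (if a \<in> ?J then cf (x b) a else 0) - (if a = b then 1 else 0)" for a
    have split: "(\<Sum>a\<in>?N. scale_fun (c a) (f a)) = (\<Sum>a\<in>?J. scale_fun (cf (x b) a) (f a)) - f b"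
      for f :: "'n mindex \<Rightarrow> nat \<Rightarrow> complex"
    proof -
      have "(\<Sum>a\<in>?N. scale_fun (c a) (f a)) = (\<Sum>a\<in>?N. if a \<in> ?J then scale_fun (cf (x b) a) (f a) else 0)
          - (\<Sum>a\<in>?N. if a = b then f a else 0)"
        unfolding sum_subtractf[symmetric]
        by (intro sum.cong refl) (auto simp: c_def fun_eq_iff fun_apply algebra_simps)
      also have "(\<Sum>a\<in>?N. if a \<in> ?J then scale_fun (cf (x b) a) (f a) else 0)
          = (\<Sum>a\<in>?J. scale_fun (cf (x b) a) (f a))"
        using JN by (intro sum.mono_neutral_cong_right) auto
      finally show ?thesis using b by simp
    qed
    have "(\<Sum>a\<in>?N. scale_fun (c a) (x a)) = 0"
      unfolding split recon[OF xV] by simp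
    from shift_null[OF this, of i] show ?thesis
      unfolding split mvT[symmetric] by simp
  qed
  have comm_less: "mv S (adj (A q)) (mv S (A p) u) = mv S (A p) (mv S (adj (A q)) u)"
    if ij: "i < j" and A: "A = (\<lambda>p::nat. if p = 0 then T i else T j)" and "p < 2" "q < 2" for i j A p q u
  proof (rule block_psd_imp_commute[OF _ that(3,4)])
    fix U :: "nat \<Rightarrow> nat \<Rightarrow> complex"
    assume U: "\<And>p. U p \<in> vecs S"
    define h where "h = (\<lambda>p::nat. if p = 0 then 0 else if p = 1 then unit_idx i else unit_idx j)"
    define X where "X = case_nat (\<lambda>u. u) (\<lambda>p. mv S (A p))"
    have X: "X q (U p) = (\<Sum>b\<in>?J. scale_fun (cf (U p) b) (x (b + h q)))" if "q < 3" for p q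
    proof -
      have "q = 0 \<or> q = 1 \<or> q = 2" using that by auto
      then show ?thesis
        by (elim disjE) (simp_all add: X_def A h_def recon[OF U] mvT)
    qed
    have hI: "b + h q \<in> ?I" if "b \<in> ?J" for b q
      using that st by (auto simp: mindices_def mdeg_add h_def)
    \<comment> \<open>By \<open>recon\<close> arbitrary vectors \<open>U p\<close> come from
      coefficients on \<open>?J\<close>, so testing the block matrix at the coefficients
      \<open>cf (U p) b\<close> covers every choice of \<open>U\<close>.\<close>
    have "(\<Sum>p<Suc 2. \<Sum>q<Suc 2. ip S (X q (U p)) (X p (U q)))
        = (\<Sum>p<3. \<Sum>q<3. \<Sum>a\<in>?J. \<Sum>b\<in>?J. cnj (cf (U p) a) * cf (U q) b * y (a + h q) (b + h p))"
    proof -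
      have "ip S (X q (U p)) (X p (U q))
          = (\<Sum>a\<in>?J. \<Sum>b\<in>?J. cnj (cf (U p) a) * cf (U q) b * y (a + h q) (b + h p))"
        if "p < 3" "q < 3" for p q
        unfolding X[OF that(1)] X[OF that(2)] ip_sum_scale_sum_scale
        by (intro sum.cong refl) (simp add: gram hI)
      then show ?thesis
        by (intro sum.cong) auto
    qed
    also have "\<dots> = (\<Sum>p<3. \<Sum>a\<in>?J. \<Sum>q<3. \<Sum>b\<in>?J. cnj (cf (U p) a) * cf (U q) b * y (a + h q) (b + h p))"
      by (rule sum.cong[OF refl], rule sum.swap)
    also have "\<dots> = (\<Sum>p<3. \<Sum>a\<in>?J. \<Sum>q<3. \<Sum>b\<in>?J.
        cnj (cf (U p) a) * shift_block_mat i j y (p, a) (q, b) * cf (U q) b)"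
      by (intro sum.cong refl) (simp add: shift_block_mat_eq[OF _ _ h_def])
    also have "\<dots> = (\<Sum>m\<in>{0..<3} \<times> ?J. \<Sum>m'\<in>{0..<3} \<times> ?J.
        cnj (cf (U (fst m)) (snd m)) * shift_block_mat i j y m m' * cf (U (fst m')) (snd m'))"
      by (simp add: sum.cartesian_product' atLeast0LessThan)
    finally show "0 \<le> Re (\<Sum>p<Suc 2. \<Sum>q<Suc 2. ip S ((case q of 0 \<Rightarrow> \<lambda>u. u | Suc p \<Rightarrow> mv S (A p)) (U p))
        ((case p of 0 \<Rightarrow> \<lambda>u. u | Suc p \<Rightarrow> mv S (A p)) (U q)))"
      using shift[OF ij] unfolding X_def hermitian_psd_def by simp
  qed
  have comm: "mv S (adj (T j)) (mv S (T i) u) = mv S (T i) (mv S (adj (T j)) u)" for i j u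
  proof -
    have less: "mv S (adj (T b)) (mv S (T a) u) = mv S (T a) (mv S (adj (T b)) u)"
      if "i < j" "a \<in> {i, j}" "b \<in> {i, j}" for i j a b
      using that comm_less[OF that(1) refl, of 0 0] comm_less[OF that(1) refl, of 0 1]
        comm_less[OF that(1) refl, of 1 0] comm_less[OF that(1) refl, of 1 1] by auto
    \<comment> \<open>For \<open>i = j\<close> the relation is normality of \<open>T i\<close>, a
      diagonal case of \<open>less\<close> for a pair of \<open>i\<close> with a second
      variable.\<close>
    have "\<exists>l. l \<noteq> i"
      using card by (metis UNIV_I card_1_singleton_iff One_nat_def less_irrefl UNIV_eq_I insertCI singletonI)
    then obtain l where "l \<noteq> i" "i \<noteq> j \<Longrightarrow> l = j" by metis
    then show ?thesis
      using less[of i l i j] less[of l i i j] by (cases "i = j") (auto simp: neq_iff)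
  qed
  obtain E z where E: "\<And>k. k < S \<Longrightarrow> E k \<in> vecs S"
    and on: "\<And>k l. k < S \<Longrightarrow> l < S \<Longrightarrow> ip S (E k) (E l) = (if k = l then 1 else 0)"
    and eig: "\<And>k i. k < S \<Longrightarrow> mv S (T i) (E k) = scale_fun (z k i) (E k)"
    and expand: "\<And>u. u \<in> vecs S \<Longrightarrow> u = (\<Sum>l<S. scale_fun (ip S (E l) u) (E l))"
    apply (rule joint_orthonormal_eigenbasis[of S T, OF comm])
    subgoal premises prems for E z
      by (rule prems(1)[of E z]) (rule prems(2-5); assumption)+
    done
  define \<zeta> where "\<zeta> k = (\<chi> i. z k i)" for k
  \<comment> \<open>\<open>x 0\<close> belongs to the constant monomial, and all \<open>x a\<close>
    arise from it by shifts, so its coordinates determine those of every \<open>x a\<close>.\<close>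
  define c where "c k = ip S (E k) (x 0)" for k
  have ipT: "ip S (E k) (mv S (T i) u) = z k i * ip S (E k) u" if "k < S" "u \<in> vecs S" for k i u
  proof -
    have "ip S (E k) (mv S (T i) u) = (\<Sum>l<S. ip S (E l) u * (z l i * ip S (E k) (E l)))"
      by (subst expand[OF that(2)]) (simp add: mv_sum mv_scale eig ip_sum_right ip_simps mult.assoc)
    also have "\<dots> = (\<Sum>l<S. if l = k then z l i * ip S (E l) u else 0)"
      using on that by (intro sum.cong) auto
    finally show ?thesis using that by simp
  qed
  have coord: "ip S (E k) (x a) = mpow (\<zeta> k) a * c k" if "k < S" "a \<in> ?I" for k a
    using that(2)
  proof (induction "mdeg a" arbitrary: a)
    case 0
    have "a = 0"
      using 0(1) by (metis mindex_decompose nat.distinct(1))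
    then show ?case by (simp add: c_def)
  next
    case (Suc m)
    have "a \<noteq> 0" using Suc(2) by auto
    then obtain b i where b: "a = b + unit_idx i" "mdeg a = Suc (mdeg b)"
      by (rule mindex_decompose)
    then have bN: "b \<in> ?N" and m: "m = mdeg b"
      using Suc by (auto simp: mindices_def)
    have "ip S (E k) (x a) = z k i * ip S (E k) (x b)"
      unfolding b(1) Tx[OF bN, symmetric] by (rule ipT[OF that(1) xV])
    also have "ip S (E k) (x b) = mpow (\<zeta> k) b * c k"
      using Suc(1)[OF m] bN NI by blast
    finally show ?case
      by (simp add: b(1) mpow_add \<zeta>_def)
  qed
  \<comment> \<open>The \<open>l\<close>-th coordinate of \<open>E k\<close>, computed through its
    expansion over \<open>?J\<close>. The case \<open>k = l\<close> shows that no \<open>c k\<close>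
    vanishes, so all \<open>S\<close> atoms carry positive weight; rescaling by \<open>c k\<close>
    gives the interpolation polynomials.\<close>
  have dual: "(\<Sum>b\<in>?J. cf (E k) b * mpow (\<zeta> l) b) * c l = (if k = l then 1 else 0)"
    if "k < S" "l < S" for k l
  proof -
    have "(if k = l then 1 else 0) = ip S (E l) (\<Sum>b\<in>?J. scale_fun (cf (E k) b) (x b))"
      using on that by (simp add: recon[OF E])
    also have "\<dots> = (\<Sum>b\<in>?J. cf (E k) b * (mpow (\<zeta> l) b * c l))"
      using that JI by (simp add: ip_sum_right ip_simps coord subset_iff)
    finally show ?thesis
      by (simp add: sum_distrib_right mult.assoc)
  qed
  have c0: "c k \<noteq> 0" if "k < S" for k
    using dual[OF that that] by auto
  show ?thesis
  proof
    show "(cmod (c k))\<^sup>2 > 0" if "k < S" for k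
      using c0[OF that] by simp
    show "y a b = (\<Sum>k<S. complex_of_real ((cmod (c k))\<^sup>2) * cnj (mpow (\<zeta> k) a) * mpow (\<zeta> k) b)"
      if ab: "a \<in> ?I" "b \<in> ?I" for a b
    proof -
      have "y a b = (\<Sum>k<S. ip S (E k) (x b) * cnj (ip S (E k) (x a)))"
        unfolding gram[OF ab] cnj_ip by (subst expand[OF xV, of b]) (simp add: ip_sum_right ip_simps)
      also have "\<dots> = (\<Sum>k<S. complex_of_real ((cmod (c k))\<^sup>2) * cnj (mpow (\<zeta> k) a) * mpow (\<zeta> k) b)"
        by (intro sum.cong refl) (simp add: coord ab complex_norm_square del: of_real_power)
      finally show ?thesis .
    qed
    show "(\<Sum>b\<in>?J. (c k * cf (E k) b) * mpow (\<zeta> l) b) = (if k = l then 1 else 0)"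
      if "k < S" "l < S" for k l
    proof -
      have "(\<Sum>b\<in>?J. (c k * cf (E k) b) * mpow (\<zeta> l) b) = c k * (\<Sum>b\<in>?J. cf (E k) b * mpow (\<zeta> l) b)"
        by (simp add: sum_distrib_left mult.assoc)
      then show ?thesis
        using dual[OF that] c0[OF that(2)] by (auto split: if_splits simp: mult.commute)
    qed
  qed
qed

section \<open>Point evaluations, feasibility and minimizers\<close>

lemma riesz_atomic:
  assumes y: "\<And>\<alpha> \<beta>. \<alpha> \<in> mindices t \<Longrightarrow> \<beta> \<in> mindices t \<Longrightarrow>
      y \<alpha> \<beta> = (\<Sum>k<r. complex_of_real (w k) * cnj (mpow (\<zeta> k) \<alpha>) * mpow (\<zeta> k) \<beta>)"
    and "\<phi> \<in> real_cpolys l" "l \<le> t"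
  shows "riesz y \<phi> = (\<Sum>k<r. complex_of_real (w k) * ceval \<phi> (\<zeta> k))"
  using moment_mat_atomic[OF y, of t \<phi> l 0 0 0] assms(2,3)
  by (fastforce simp: moment_mat_0_0 real_cpolys_def mindices_def)

text \<open>These are the truncated moments of the Dirac measure at \<open>z\<close>: the localizing
  matrix of \<open>g i\<close> is the number g_i(z), nonnegative on the set, times a rank-one
  positive semidefinite matrix. Hence the relaxation bounds the minimum from below.\<close>

lemma point_evaluation_feasible:
  fixes g :: "nat \<Rightarrow> 'n::finite cpoly"
  assumes z: "z \<in> semialg_set m g"
    and g: "\<And>i. i \<in> {1..m} \<Longrightarrow> g i \<in> real_cpolys (kg i) \<and> kg i \<le> d"
  shows "(\<lambda>\<alpha> \<beta>. if \<alpha> \<in> mindices d \<and> \<beta> \<in> mindices d then cnj (mpow z \<alpha>) * mpow z \<beta> else 0)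
    \<in> moment_feasible d m g kg" (is "?y \<in> _")
proof -
  \<comment> \<open>A sum over one index with weight 1, the shape that
    \<open>moment_mat_atomic\<close> expects for a single atom.\<close>
  have y: "?y \<alpha> \<beta> = (\<Sum>k<1::nat. complex_of_real 1 * cnj (mpow z \<alpha>) * mpow z \<beta>)"
    if "\<alpha> \<in> mindices d" "\<beta> \<in> mindices d" for \<alpha> \<beta>
    using that by simp
  have rank1: "hermitian_psd N M"
    if M: "\<And>a b. a \<in> N \<Longrightarrow> b \<in> N \<Longrightarrow> M a b = complex_of_real c * cnj (mpow z a) * mpow z b" and "c \<ge> 0"
    for N :: "'n mindex set" and M c
  proof -
    have "(\<Sum>a\<in>N. \<Sum>b\<in>N. cnj (v a) * M a b * v b)
        = complex_of_real (c * (cmod (\<Sum>b\<in>N. v b * mpow z b))\<^sup>2)" for v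
      unfolding of_real_mult sum_rank_one[symmetric] by (intro sum.cong refl) (simp add: M)
    then show ?thesis
      using \<open>c \<ge> 0\<close> by (simp add: hermitian_psd_def M)
  qed
  have "hermitian_psd (mindices (d - kg i)) (moment_mat (g i) ?y)" if i: "i \<in> {1..m}" for i
  proof (rule rank1)
    have gi: "g i \<in> real_cpolys (kg i)" "kg i \<le> d" using g[OF i] by auto
    show "0 \<le> Re (ceval (g i) z)"
      using z i by (simp add: semialg_set_def)
    have "ceval (g i) z \<in> \<real>" using gi by (simp add: real_cpolys_def)
    then have ev: "complex_of_real (Re (ceval (g i) z)) = ceval (g i) z" by simp
    fix a b :: "'n mindex" assume ab: "a \<in> mindices (d - kg i)" "b \<in> mindices (d - kg i)"
    have "moment_mat (g i) ?y a b
        = (\<Sum>k<1::nat. complex_of_real 1 * ceval (g i) z * cnj (mpow z a) * mpow z b)"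
      by (rule moment_mat_atomic[OF y _ ab, where l = "kg i"])
         (use gi in \<open>auto simp: real_cpolys_def\<close>)
    then show "moment_mat (g i) ?y a b
        = complex_of_real (Re (ceval (g i) z)) * cnj (mpow z a) * mpow z b"
      by (simp add: ev)
  qed
  moreover have "hermitian_psd (mindices d) (moment_mat 1 ?y)"
    by (rule rank1[where c = 1]) (simp_all add: moment_mat_1)
  moreover have "?y \<in> herm_seqs d"
    by (auto simp: herm_seqs_def)
  ultimately show ?thesis
    by (simp add: moment_feasible_def mindices_def)
qed

lemma riesz_point_evaluation:
  fixes \<phi> :: "'n::finite cpoly"
  assumes "\<phi> \<in> real_cpolys l" "l \<le> d"
  shows "riesz (\<lambda>\<alpha> \<beta>. if \<alpha> \<in> mindices d \<and> \<beta> \<in> mindices d then cnj (mpow z \<alpha>) * mpow z \<beta> else 0) \<phi> = ceval \<phi> z"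
proof -
  have "riesz (\<lambda>\<alpha> \<beta>. if \<alpha> \<in> mindices d \<and> \<beta> \<in> mindices d then cnj (mpow z \<alpha>) * mpow z \<beta> else 0) \<phi>
      = (\<Sum>k<1::nat. complex_of_real 1 * ceval \<phi> z)"
    by (rule riesz_atomic[OF _ assms]) simp
  then show ?thesis by simp
qed

theorem proposition3p5:
  fixes f :: "'n::{finite,linorder} cpoly"
    and g :: "nat \<Rightarrow> 'n cpoly"
    and k :: nat and kg :: "nat \<Rightarrow> nat"
    and m d t dmin dK S :: nat
    and K :: "(complex, 'n) vec set"
    and y :: "'n mindex \<Rightarrow> 'n mindex \<Rightarrow> complex"
  assumes "CARD('n) > 1" and "m \<ge> 1"
    and "has_cdegree f k"
    and "\<forall>i\<in>{1..m}. has_cdegree (g i) (kg i)"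
    and "K = semialg_set m g"
    and "\<exists>R>0. \<exists>i\<in>{1..m}. \<exists>i'\<in>{1..m}. g i = sphere_poly R \<and> g i' = - sphere_poly R"
    and "dmin = Max (insert k (kg ` {1..m}))"
    and "dK = Max (kg ` {1..m})"
    and "dmin \<le> d"
    and "moment_optimal d f m g kg y"
    and "dmin \<le> t" and "t \<le> d"
    and "mat_rank (mindices t) (moment_mat 1 y) = S"
    and "mat_rank (mindices (t - dK)) (moment_mat 1 y) = S"
    and "\<forall>i j. i < j \<longrightarrow>
           hermitian_psd ({0..<3} \<times> mindices (t - dK)) (shift_block_mat i j y)"
  shows "moment_value d f m g kg = opt_value f K \<and>
         (\<exists>A \<subseteq> global_solutions f K. finite A \<and> card A = S)"
proof -
  obtain R i\<^sub>1 i\<^sub>2 where sph: "i\<^sub>1 \<in> {1..m}" "i\<^sub>2 \<in> {1..m}" "g i\<^sub>1 = sphere_poly R" "g i\<^sub>2 = - sphere_poly R"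
    using assms(6) by blast
  have g: "g i \<in> real_cpolys (kg i)" if "i \<in> {1..m}" for i
    using assms(4) that by (simp add: has_cdegree_def)
  have f: "f \<in> real_cpolys k" using assms(3) by (simp add: has_cdegree_def)
  have kg: "kg i \<le> dK" if "i \<in> {1..m}" for i
    unfolding assms(8) using that by simp
  have dK: "dK \<le> t"
  proof -
    have "dK \<in> kg ` {1..m}" unfolding assms(8) using assms(2) by (intro Max_in) auto
    then have "dK \<le> dmin" unfolding assms(7) by simp
    then show ?thesis using assms(11) by simp
  qed
  have kt: "k \<le> t"
    using assms(11) unfolding assms(7) by simp
  have kg1: "kg i\<^sub>1 = 1" "kg i\<^sub>2 = 1"
    using assms(4) sph by (blast intro: has_cdegree_sphere_poly)+
  have feas: "y \<in> moment_feasible d m g kg"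
    and opt: "\<And>y'. y' \<in> moment_feasible d m g kg \<Longrightarrow> Re (riesz y f) \<le> Re (riesz y' f)"
    using assms(10) by (auto simp: moment_optimal_def)
  have mm1: "moment_mat 1 y = y" by (simp add: fun_eq_iff moment_mat_1)
  have psd: "hermitian_psd (mindices d) y"
    and loc: "\<And>i. i \<in> {1..m} \<Longrightarrow> hermitian_psd (mindices (d - kg i)) (moment_mat (g i) y)"
    and y00: "y 0 0 = 1"
    using feas by (auto simp: moment_feasible_def mm1)
  have sphere: "(\<Sum>j\<in>UNIV. y (\<alpha> + unit_idx j) (\<beta> + unit_idx j)) = complex_of_real (R\<^sup>2) * y \<alpha> \<beta>"
    if "\<alpha> \<in> mindices (t - 1)" "\<beta> \<in> mindices (t - 1)" for \<alpha> \<beta>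
  proof -
    have "moment_mat (sphere_poly R) y \<alpha> \<beta> = 0"
    proof (rule hermitian_psd_minus_zero[OF finite_mindices])
      show "hermitian_psd (mindices (d - 1)) (moment_mat (sphere_poly R) y)"
        using loc[OF sph(1)] sph kg1 by simp
      show "hermitian_psd (mindices (d - 1)) (\<lambda>a b. - moment_mat (sphere_poly R) y a b)"
        using loc[OF sph(2)] sph kg1 by (simp add: moment_mat_uminus[abs_def])
      show "\<alpha> \<in> mindices (d - 1)" "\<beta> \<in> mindices (d - 1)"
        using that assms(12) by (auto simp: mindices_def)
    qed
    then show ?thesis by (simp add: moment_mat_sphere)
  qed
  have psdt: "hermitian_psd (mindices t) y"
    using psd finite_mindices mindices_mono[OF assms(12)] by (rule hermitian_psd_subset)
  \<comment> \<open>Strict because the sphere constraints have degree 1; this leaves room for one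
    shift.\<close>
  have st: "t - dK < t"
    using kg[OF sph(1)] kg1 dK by simp
  obtain \<zeta> w P where w: "\<And>l. l < S \<Longrightarrow> w l > 0"
    and yat: "\<And>\<alpha> \<beta>. \<alpha> \<in> mindices t \<Longrightarrow> \<beta> \<in> mindices t \<Longrightarrow>
        y \<alpha> \<beta> = (\<Sum>l<S. complex_of_real (w l) * cnj (mpow (\<zeta> l) \<alpha>) * mpow (\<zeta> l) \<beta>)"
    and interp: "\<And>l l'. l < S \<Longrightarrow> l' < S \<Longrightarrow>
        (\<Sum>b\<in>mindices (t - dK). P l b * mpow (\<zeta> l') b) = (if l = l' then 1 else 0)"
    apply (rule atomic_representation[OF assms(1) st psdt assms(13,14)[unfolded mm1], where R = R])
      apply (rule sphere; assumption)
     apply (rule assms(15)[rule_format], assumption)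
    subgoal premises prems for \<zeta> w P
      by (rule prems(1)[of w \<zeta> P]) (rule prems(2-4); assumption)+
    done
  have inK: "\<zeta> l \<in> K" if l: "l < S" for l
    unfolding assms(5) semialg_set_def
  proof (safe)
    fix i assume i: "i \<in> {1..m}"
    let ?J = "mindices (t - dK) :: 'n mindex set"
    have sub: "?J \<subseteq> mindices (d - kg i)"
      using kg[OF i] assms(12) by (intro mindices_mono) auto
    have "moment_mat (g i) y a b = (\<Sum>q<S. complex_of_real (w q) * ceval (g i) (\<zeta> q) * cnj (mpow (\<zeta> q) a) * mpow (\<zeta> q) b)"
      if "a \<in> ?J" "b \<in> ?J" for a b
      by (rule moment_mat_atomic[OF yat _ that, where l = "kg i"])
         (use g[OF i] kg[OF i] dK in \<open>auto simp: real_cpolys_def\<close>)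
    \<comment> \<open>The localizing form is tested at the interpolation polynomial of atom
      \<open>l\<close>: it is 1 there and 0 at the other atoms, so only the weight times g_i at that
      atom remains.\<close>
    then have "(\<Sum>a\<in>?J. \<Sum>b\<in>?J. cnj (P l a) * moment_mat (g i) y a b * P l b)
        = (\<Sum>a\<in>?J. \<Sum>b\<in>?J. \<Sum>q<S. cnj (P l a) *
            (complex_of_real (w q) * ceval (g i) (\<zeta> q) * cnj (mpow (\<zeta> q) a) * mpow (\<zeta> q) b) * P l b)"
      by (simp add: sum_distrib_left sum_distrib_right)
    also have "\<dots> = (\<Sum>q<S. \<Sum>a\<in>?J. \<Sum>b\<in>?J. cnj (P l a) *
            (complex_of_real (w q) * ceval (g i) (\<zeta> q) * cnj (mpow (\<zeta> q) a) * mpow (\<zeta> q) b) * P l b)"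
      by (rule trans[OF _ sum.swap], rule sum.cong[OF refl], rule sum.swap)
    also have "\<dots> = (\<Sum>q<S. if q = l then complex_of_real (w q) * ceval (g i) (\<zeta> q) else 0)"
      unfolding sum_rank_one using interp l by (intro sum.cong) auto
    also have "\<dots> = complex_of_real (w l) * ceval (g i) (\<zeta> l)"
      using l by simp
    finally have "0 \<le> Re (complex_of_real (w l) * ceval (g i) (\<zeta> l))"
      using sesq_self_nonneg(2)[OF hermitian_psd_subset[OF loc[OF i] finite_mindices sub], of "P l"]
      by (simp only: sesq_def)
    then show "0 \<le> Re (ceval (g i) (\<zeta> l))"
      using w[OF l] by (simp add: zero_le_mult_iff)
  qed
  define L where "L = Re (riesz y f)"
  have lower: "L \<le> Re (ceval f z)" if "z \<in> K" for z
  proof -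
    have "k \<le> d" "kg i \<le> d" if "i \<in> {1..m}" for i
      using kt assms(12) kg[OF that] dK by auto
    then show ?thesis
      using opt[OF point_evaluation_feasible[of z m g kg d]] riesz_point_evaluation[OF f, of d z]
        that g kt assms(12) by (simp add: L_def assms(5))
  qed
  have sum_w: "(\<Sum>l<S. w l) = 1"
  proof -
    have "complex_of_real (\<Sum>l<S. w l) = 1"
      using yat[of 0 0] y00 by (simp add: mindices_def)
    then show ?thesis by (simp only: of_real_eq_1_iff)
  qed
  have "riesz y f = (\<Sum>l<S. complex_of_real (w l) * ceval f (\<zeta> l))"
    by (rule riesz_atomic[OF yat f kt])
  then have "L = (\<Sum>l<S. w l * Re (ceval f (\<zeta> l)))"
    by (simp add: L_def)
  then have "(\<Sum>l<S. w l * (Re (ceval f (\<zeta> l)) - L)) = 0"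
    by (simp add: right_diff_distrib sum_subtractf sum_distrib_right[symmetric] sum_w)
  moreover have "0 \<le> w l * (Re (ceval f (\<zeta> l)) - L)" if "l < S" for l
    using w[OF that] lower[OF inK[OF that]] by simp
  ultimately have avg: "\<forall>l\<in>{..<S}. w l * (Re (ceval f (\<zeta> l)) - L) = 0"
    by (subst sum_nonneg_eq_0_iff[symmetric]) auto
  have attained: "Re (ceval f (\<zeta> l)) = L" if "l < S" for l
    using bspec[OF avg, of l] w[OF that] that by simp
  \<comment> \<open>Provides atom 0 as a point of \<open>K\<close> at which the value
    \<open>L\<close> is reached.\<close>
  have "S > 0" using sum_w by (cases "S = 0") auto
  have "moment_value d f m g kg = ereal L"
    unfolding moment_value_def
    by (rule antisym[OF INF_lower2[OF feas] INF_greatest]) (auto simp: L_def opt)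
  moreover have "opt_value f K = ereal L"
    unfolding opt_value_def
    by (rule antisym[OF INF_lower2[OF inK[OF \<open>S > 0\<close>]] INF_greatest])
       (auto simp: attained[OF \<open>S > 0\<close>] lower)
  moreover have "\<zeta> ` {..<S} \<subseteq> global_solutions f K"
    using inK attained lower by (auto simp: global_solutions_def)
  \<comment> \<open>Interpolation separates the atoms, so the \<open>S\<close> minimizers are
    distinct.\<close>
  moreover have "inj_on \<zeta> {..<S}"
  proof (rule inj_onI)
    fix l l' assume "l \<in> {..<S}" "l' \<in> {..<S}" "\<zeta> l = \<zeta> l'"
    with interp[of l l] interp[of l l'] show "l = l'" by (auto split: if_splits)
  qed
  ultimately show ?thesis
    by (metis card_image card_lessThan finite_imageI finite_lessThan)
qed

end
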